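(* Let $F$ be a non-abelian free group, freely generated by $S$, and let $\omega\in F$ be a non-empty reduced word of length $\ell$ over $S\cup S^{-1}$. Then the (big) Brooks quasimorphism $\phi_\omega\colon F\to\mathbb{R}$ is a quasimorphism of $F$. Furthermore, for all $\alpha_1\in H_{b}^{n}(F;\mathbb{R})$ and $\alpha_2\in H_{b}^{m}(F;\mathbb{R})$, the cup products $\alpha_1 \cup [\delta^1\widehat{\phi_\omega}]$ and $[\delta^1\widehat{\phi_\omega}]\cup \alpha_2$ as well as the Massey triple product $\langle \alpha_1, [\delta^1\widehat{\phi_\omega}], \alpha_2 \rangle$ are trivial.
   Context: Bounded cohomology: for a discrete group $\Gamma$, $C^n_b(\Gamma;\mathbb{R})=\ell^\infty(\Gamma^{n+1},\mathbb{R})^\Gamma$ is the space of bounded functions invariant under the diagonal left translation action, with the simplicial coboundary $\delta^n f(g_0,\ldots,g_{n+1})=\sum_{i=0}^{n+1}(-1)^i f(g_0,\ldots,\widehat{g_i},\ldots,g_{n+1})$; its cohomology is $H^*_b(\Gamma;\mathbb{R})$. The cup product is induced by $(f\cup g)(g_0,\ldots,g_{p+q})=f(g_0,\ldots,g_p)\,g(g_p,\ldots,g_{p+q})$. Massey triple product: let $\alpha_1\in H_b^p$, $\alpha\in H_b^k$, $\alpha_2\in H_b^q$ with $\alpha_1\cup\alpha=0$ and $\alpha\cup\alpha_2=0$. Then $\langle\alpha_1,\alpha,\alpha_2\rangle\subset H^{p+q+k-1}_b(\Gamma;\mathbb{R})$ is the set of all classes $(-1)^k[(-1)^p\omega_1\cup\beta_2-\beta_1\cup\omega_2]$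 where $\omega_1,\omega',\omega_2$ are cocycles representing $\alpha_1,\alpha,\alpha_2$, and $\beta_1,\beta_2$ are bounded $\Gamma$-invariant cochains with $\delta\beta_1=\omega_1\cup\omega'$ and $\delta\beta_2=\omega'\cup\omega_2$. It is called trivial if it contains the zero class. Quasimorphism of $\Gamma$: a map $\varphi\colon\Gamma\to\mathbb{R}$ with $\sup_{g,h\in\Gamma}|\varphi(g)+\varphi(h)-\varphi(gh)|<\infty$. Put $\widehat{\varphi}\colon\Gamma^2\to\mathbb{R}$, $(g,h)\mapsto\varphi(g^{-1}h)$; then $\delta^1\widehat{\varphi}$ is a bounded $\Gamma$-invariant cocycle and defines a class $[\delta^1\widehat{\varphi}]\in H^2_b(\Gamma;\mathbb{R})$. Brooks quasimorphism: elements of $F$ are viewed as reduced words over $S\cup S^{-1}$. Let $\chi_\omega\colon F\to\{-1,0,1\}$ be $+1$ on $\omega$, $-1$ on $\omega^{-1}$ and $0$ elsewhere. Then $\phi_\omega(g)=\sum_{i=1}^{N-\ell+1}\chi_\omega(s_i\cdots s_{i+\ell-1})$, where $g=s_1\cdots s_N$ is the reduced word of $g$ (the sum is $0$ if $N<\ell$); i.e. $\phi_\omega(g)$ is the number of (possibly overlapping) occurrences of $\omega$ in $g$ minus that of $\omega^{-1}$.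
   Formalization: The degrees n and m are assumed to be at least 1; in degree 0 the claim fails, e.g. for α1 = 1 and ω = ab the cup product is the class of the Brooks quasimorphism itself, which is nonzero. *)

theory Defs
  imports Complex_Main "HOL-Algebra.Group"
begin

section \<open>Bounded cohomology of a discrete group\<close>

text \<open>
  An \<open>n\<close>-cochain is a function on \<open>(n+1)\<close>-tuples of group elements. Tuples are lists, and
  cochains are required to vanish on every list that is not a tuple of the right length over the
  carrier, so that equality of cochains is equality of functions.
\<close>

definition tuples :: "('a, 'b) monoid_scheme \<Rightarrow> nat \<Rightarrow> 'a list set" where
  "tuples G n = {xs. length xs = Suc n \<and> set xs \<subseteq> carrier G}"

definition coboundary :: "('a, 'b) monoid_scheme \<Rightarrow> nat \<Rightarrow> ('a list \<Rightarrow> real) \<Rightarrow> ('a list \<Rightarrow> real)" where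
  "coboundary G n f = (\<lambda>xs. if xs \<in> tuples G (Suc n)
     then \<Sum>i\<le>Suc n. (-1) ^ i * f (take i xs @ drop (Suc i) xs) else 0)"

definition bounded_cochains :: "('a, 'b) monoid_scheme \<Rightarrow> nat \<Rightarrow> ('a list \<Rightarrow> real) set" where
  "bounded_cochains G n = {f.
     (\<forall>xs. xs \<notin> tuples G n \<longrightarrow> f xs = 0) \<and>
     (\<exists>C. \<forall>xs \<in> tuples G n. \<bar>f xs\<bar> \<le> C) \<and>
     (\<forall>g \<in> carrier G. \<forall>xs \<in> tuples G n. f (map (\<lambda>x. g \<otimes>\<^bsub>G\<^esub> x) xs) = f xs)}"

definition bounded_cocycles :: "('a, 'b) monoid_scheme \<Rightarrow> nat \<Rightarrow> ('a list \<Rightarrow> real) set" where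
  "bounded_cocycles G n = {f \<in> bounded_cochains G n. coboundary G n f = (\<lambda>_. 0)}"

definition bounded_coboundaries :: "('a, 'b) monoid_scheme \<Rightarrow> nat \<Rightarrow> ('a list \<Rightarrow> real) set" where
  "bounded_coboundaries G n = (case n of
     0 \<Rightarrow> {\<lambda>_. 0}
   | Suc m \<Rightarrow> coboundary G m ` bounded_cochains G m)"

definition cohomologous ::
    "('a, 'b) monoid_scheme \<Rightarrow> nat \<Rightarrow> (('a list \<Rightarrow> real) \<times> ('a list \<Rightarrow> real)) set" where
  "cohomologous G n = {(f, f'). f \<in> bounded_cocycles G n \<and> f' \<in> bounded_cocycles G n \<and>
     (\<lambda>xs. f' xs - f xs) \<in> bounded_coboundaries G n}"

definition Hb :: "('a, 'b) monoid_scheme \<Rightarrow> nat \<Rightarrow> ('a list \<Rightarrow> real) set set" where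
  "Hb G n = bounded_cocycles G n // cohomologous G n"

definition Hb_class :: "('a, 'b) monoid_scheme \<Rightarrow> nat \<Rightarrow> ('a list \<Rightarrow> real) \<Rightarrow> ('a list \<Rightarrow> real) set" where
  "Hb_class G n f = cohomologous G n `` {f}"

definition Hb_zero :: "('a, 'b) monoid_scheme \<Rightarrow> nat \<Rightarrow> ('a list \<Rightarrow> real) set" where
  "Hb_zero G n = Hb_class G n (\<lambda>_. 0)"

definition cup ::
    "('a, 'b) monoid_scheme \<Rightarrow> nat \<Rightarrow> nat \<Rightarrow> ('a list \<Rightarrow> real) \<Rightarrow> ('a list \<Rightarrow> real) \<Rightarrow> ('a list \<Rightarrow> real)" where
  "cup G p q f g = (\<lambda>xs. if xs \<in> tuples G (p + q) then f (take (Suc p) xs) * g (drop p xs) else 0)"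

text \<open>
  The product of two classes is the union of the classes of all products of representatives;
  by well-definedness of the product all of these coincide.
\<close>

definition Hb_cup ::
    "('a, 'b) monoid_scheme \<Rightarrow> nat \<Rightarrow> nat \<Rightarrow> ('a list \<Rightarrow> real) set \<Rightarrow> ('a list \<Rightarrow> real) set \<Rightarrow> ('a list \<Rightarrow> real) set" where
  "Hb_cup G p q A B = (\<Union>f\<in>A. \<Union>g\<in>B. Hb_class G (p + q) (cup G p q f g))"

text \<open>
  The Massey triple product is only meaningful if both adjacent cup products vanish. The degrees
  use truncated subtraction, so the definition is intended for \<open>p + k \<ge> 1\<close> and \<open>k + q \<ge> 1\<close>.
\<close>

definition massey ::
    "('a, 'b) monoid_scheme \<Rightarrow> nat \<Rightarrow> nat \<Rightarrow> nat \<Rightarrow>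
     ('a list \<Rightarrow> real) set \<Rightarrow> ('a list \<Rightarrow> real) set \<Rightarrow> ('a list \<Rightarrow> real) set \<Rightarrow> ('a list \<Rightarrow> real) set set" where
  "massey G p k q A1 A A2 =
     {Hb_class G (p + q + k - 1)
        (\<lambda>xs. (-1) ^ k * ((-1) ^ p * cup G p (k + q - 1) w1 b2 xs - cup G (p + k - 1) q b1 w2 xs))
      | w1 w w2 b1 b2.
        w1 \<in> A1 \<and> w \<in> A \<and> w2 \<in> A2 \<and>
        b1 \<in> bounded_cochains G (p + k - 1) \<and> b2 \<in> bounded_cochains G (k + q - 1) \<and>
        coboundary G (p + k - 1) b1 = cup G p k w1 w \<and>
        coboundary G (k + q - 1) b2 = cup G k q w w2}"

definition massey_trivial ::
    "('a, 'b) monoid_scheme \<Rightarrow> nat \<Rightarrow> nat \<Rightarrow> nat \<Rightarrow>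
     ('a list \<Rightarrow> real) set \<Rightarrow> ('a list \<Rightarrow> real) set \<Rightarrow> ('a list \<Rightarrow> real) set \<Rightarrow> bool" where
  "massey_trivial G p k q A1 A A2 \<longleftrightarrow> Hb_zero G (p + q + k - 1) \<in> massey G p k q A1 A A2"


section \<open>Quasimorphisms\<close>

definition quasimorphism :: "('a, 'b) monoid_scheme \<Rightarrow> ('a \<Rightarrow> real) \<Rightarrow> bool" where
  "quasimorphism G \<phi> \<longleftrightarrow>
     (\<exists>C. \<forall>g \<in> carrier G. \<forall>h \<in> carrier G. \<bar>\<phi> g + \<phi> h - \<phi> (g \<otimes>\<^bsub>G\<^esub> h)\<bar> \<le> C)"

definition qm_hat :: "('a, 'b) monoid_scheme \<Rightarrow> ('a \<Rightarrow> real) \<Rightarrow> ('a list \<Rightarrow> real)" where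
  "qm_hat G \<phi> = (\<lambda>xs. if xs \<in> tuples G 1 then \<phi> (inv\<^bsub>G\<^esub> (xs ! 0) \<otimes>\<^bsub>G\<^esub> xs ! 1) else 0)"

definition qm_class :: "('a, 'b) monoid_scheme \<Rightarrow> ('a \<Rightarrow> real) \<Rightarrow> ('a list \<Rightarrow> real) set" where
  "qm_class G \<phi> = Hb_class G 2 (coboundary G 1 (qm_hat G \<phi>))"


section \<open>Free groups and Brooks quasimorphisms\<close>

text \<open>
  A letter \<open>(s, True)\<close> stands for the generator \<open>s\<close> and \<open>(s, False)\<close> for its inverse. A group is
  freely generated by \<open>S\<close> if every element is the value of exactly one reduced word.
\<close>

definition reduced_words :: "'a set \<Rightarrow> ('a \<times> bool) list set" where
  "reduced_words S = {w. fst ` set w \<subseteq> S \<and>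
     successively (\<lambda>x y. \<not> (fst x = fst y \<and> snd x \<noteq> snd y)) w}"

definition letter_value :: "('a, 'b) monoid_scheme \<Rightarrow> 'a \<times> bool \<Rightarrow> 'a" where
  "letter_value G x = (if snd x then fst x else inv\<^bsub>G\<^esub> (fst x))"

definition word_value :: "('a, 'b) monoid_scheme \<Rightarrow> ('a \<times> bool) list \<Rightarrow> 'a" where
  "word_value G w = foldr (\<lambda>x g. letter_value G x \<otimes>\<^bsub>G\<^esub> g) w \<one>\<^bsub>G\<^esub>"

definition freely_generated :: "('a, 'b) monoid_scheme \<Rightarrow> 'a set \<Rightarrow> bool" where
  "freely_generated G S \<longleftrightarrow> S \<subseteq> carrier G \<and>
     bij_betw (word_value G) (reduced_words S) (carrier G)"

definition reduced_word :: "('a, 'b) monoid_scheme \<Rightarrow> 'a set \<Rightarrow> 'a \<Rightarrow> ('a \<times> bool) list" where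
  "reduced_word G S g = inv_into (reduced_words S) (word_value G) g"

definition brooks_chi :: "('a, 'b) monoid_scheme \<Rightarrow> 'a \<Rightarrow> 'a \<Rightarrow> real" where
  "brooks_chi G \<omega> g = (if g = \<omega> then 1 else if g = inv\<^bsub>G\<^esub> \<omega> then -1 else 0)"

text \<open>
  Positions are counted from \<open>0\<close>. For a word of length \<open>N\<close> shorter than \<open>\<omega>\<close> the truncated
  subtraction makes the range of summation empty.
\<close>

definition brooks :: "('a, 'b) monoid_scheme \<Rightarrow> 'a set \<Rightarrow> 'a \<Rightarrow> 'a \<Rightarrow> real" where
  "brooks G S \<omega> g = (let s = reduced_word G S g; l = length (reduced_word G S \<omega>) in
     \<Sum>i < Suc (length s) - l. brooks_chi G \<omega> (word_value G (take l (drop i s))))"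

end

theory Submission
  imports Defs
begin

text \<open>
  Idea. For a function \<open>h\<close> on \<open>F\<close> let \<open>\<Phi> h a b\<close> be the sum of \<open>h\<close> over the copies of \<open>\<omega>\<close> on the
  geodesic from \<open>a\<close> to \<open>b\<close> in the Cayley tree, each copy represented by its starting point, minus the
  same sum for the reversed geodesic. Then \<open>\<Phi> 1 a b\<close> is the Brooks quasimorphism of \<open>a\<^sup>-\<^sup>1 b\<close>, and since
  geodesic triangles are tripods, \<open>\<Phi> h b c - \<Phi> h a c + \<Phi> h a b\<close> is bounded by a multiple of \<open>sup |h|\<close>.

  For cocycles \<open>f\<close> and \<open>g\<close> let \<open>\<zeta>(f, g)\<close> send \<open>(A, B)\<close> to \<open>\<Phi> (\<lambda>x. f(A, x) g(x, B)) a b\<close>, where \<open>a\<close> is the last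
  entry of \<open>A\<close> and \<open>b\<close> the first of \<open>B\<close>. Up to sign, the cocycle identities give
  \<open>\<delta>\<zeta>(f, g) = f \<union> \<zeta>(1, g) + \<zeta>(f, 1) \<union> g - \<Xi>(f, g)\<close>, where \<open>\<Xi>\<close> is the triangle defect of \<open>\<Phi>\<close> and
  hence bounded. Similar identities hold when \<open>g\<close> or \<open>f\<close> is the constant one-cochain \<open>1\<close>, although this
  is not a cocycle; they yield bounded primitives \<open>\<Xi>(f, 1)\<close> and \<open>\<Xi>(1, g)\<close> of the two cup products.
  The Massey product formed with these primitives is represented by
  \<open>\<delta>(f \<union> \<zeta>(1, g) + \<zeta>(f, 1) \<union> g) = \<delta>\<Xi>(f, g)\<close>.
\<close>

section \<open>The simplicial coboundary on lists\<close>

text \<open>A form of the coboundary without degree or carrier. Recursion on the list turns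
  identities between alternating sums into inductions and lets a tuple be split with
  \<open>@\<close>.\<close>

fun bd :: "('a list \<Rightarrow> real) \<Rightarrow> 'a list \<Rightarrow> real" where
  "bd f [] = 0"
| "bd f (x # xs) = f xs - bd (\<lambda>ys. f (x # ys)) xs"

lemma bd_eq_sum: "bd f xs = (\<Sum>i<length xs. (-1) ^ i * f (take i xs @ drop (Suc i) xs))"
  by (induction f xs rule: bd.induct)
     (simp_all add: sum.lessThan_Suc_shift sum_negf del: sum.lessThan_Suc)

lemma bd_cong:
  assumes "\<And>zs. Suc (length zs) = length xs \<Longrightarrow> set zs \<subseteq> set xs \<Longrightarrow> f zs = g zs"
  shows "bd f xs = bd g xs"
  unfolding bd_eq_sum
proof (rule sum.cong[OF refl])
  fix i assume "i \<in> {..<length xs}"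
  moreover have "set (take i xs @ drop (Suc i) xs) \<subseteq> set xs"
    using set_take_subset[of i xs] set_drop_subset[of "Suc i" xs] by auto
  ultimately show "(-1) ^ i * f (take i xs @ drop (Suc i) xs) = (-1) ^ i * g (take i xs @ drop (Suc i) xs)"
    using assms[of "take i xs @ drop (Suc i) xs"] by simp
qed

lemma bd_diff: "bd (\<lambda>zs. f zs - g zs) xs = bd f xs - bd g xs"
  by (simp add: bd_eq_sum sum_subtractf algebra_simps)

lemma bd_mult_left: "bd (\<lambda>zs. c * f zs) xs = c * bd f xs"
  by (simp add: bd_eq_sum sum_distrib_left algebra_simps)

lemma bd_mult_right: "bd (\<lambda>zs. f zs * c) xs = bd f xs * c"
  using bd_mult_left[of c f xs] by (simp add: mult.commute)

text \<open>In the induction step the two copies of \<open>bd f xs\<close> cancel, and what remains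
  is the same double sum with \<open>x\<close> kept in front.\<close>

lemma bd_bd: "bd (bd f) xs = 0"
proof (induction f xs rule: bd.induct)
  case (2 f x xs)
  have "bd (bd f) (x # xs) = bd f xs - bd (\<lambda>ys. f ys - bd (\<lambda>zs. f (x # zs)) ys) xs"
    by simp
  then show ?case
    using 2 by (simp add: bd_diff del: bd.simps)
qed simp

text \<open>The deleted entry lies in \<open>xs\<close> or in \<open>ys\<close>; in the second case
  its position is shifted by \<open>length xs\<close>, which accounts for the sign.\<close>

lemma bd_append:
  "bd f (xs @ ys) = bd (\<lambda>zs. f (zs @ ys)) xs + (-1) ^ length xs * bd (\<lambda>zs. f (xs @ zs)) ys"
  by (induction xs arbitrary: f) simp_all

lemma bd_map: "bd f (map h xs) = bd (\<lambda>zs. f (map h zs)) xs"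
  by (induction xs arbitrary: f) simp_all

lemma bd_abs_le:
  assumes "\<And>zs. Suc (length zs) = length xs \<Longrightarrow> set zs \<subseteq> set xs \<Longrightarrow> \<bar>f zs\<bar> \<le> C"
  shows "\<bar>bd f xs\<bar> \<le> real (length xs) * C"
proof -
  have "\<bar>bd f xs\<bar> \<le> (\<Sum>i<length xs. \<bar>(-1) ^ i * f (take i xs @ drop (Suc i) xs)\<bar>)"
    unfolding bd_eq_sum by (rule sum_abs)
  also have "\<dots> \<le> (\<Sum>i<length xs. C)"
  proof (rule sum_mono)
    fix i assume "i \<in> {..<length xs}"
    moreover have "set (take i xs @ drop (Suc i) xs) \<subseteq> set xs"
      using set_take_subset[of i xs] set_drop_subset[of "Suc i" xs] by auto
    ultimately show "\<bar>(-1) ^ i * f (take i xs @ drop (Suc i) xs)\<bar> \<le> C"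
      using assms[of "take i xs @ drop (Suc i) xs"] by (simp add: abs_mult power_abs)
  qed
  finally show ?thesis by simp
qed

lemma coboundary_eq_bd: "xs \<in> tuples G (Suc n) \<Longrightarrow> coboundary G n f xs = bd f xs"
  by (simp add: coboundary_def bd_eq_sum tuples_def lessThan_Suc_atMost)

lemma coboundary_outside: "xs \<notin> tuples G (Suc n) \<Longrightarrow> coboundary G n f xs = 0"
  by (simp add: coboundary_def)

lemma coboundary_diff:
  "coboundary G n (\<lambda>xs. f xs - g xs) xs = coboundary G n f xs - coboundary G n g xs"
  by (cases "xs \<in> tuples G (Suc n)") (simp_all add: coboundary_eq_bd coboundary_outside bd_diff)

lemma coboundary_mult_left:
  "coboundary G n (\<lambda>xs. c * f xs) xs = c * coboundary G n f xs"
  by (cases "xs \<in> tuples G (Suc n)") (simp_all add: coboundary_eq_bd coboundary_outside bd_mult_left)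

lemma coboundary_add:
  "coboundary G n (\<lambda>xs. f xs + g xs) xs = coboundary G n f xs + coboundary G n g xs"
  using coboundary_diff[of G n f "\<lambda>xs. (-1) * g xs" xs] coboundary_mult_left[of G n "-1" g xs]
  by simp

lemma coboundary_zero: "coboundary G n (\<lambda>_. 0) = (\<lambda>_. 0)"
  using coboundary_mult_left[of G n 0 "\<lambda>_. 0"] by (simp add: fun_eq_iff)

lemma coboundary_coboundary: "coboundary G (Suc n) (coboundary G n f) = (\<lambda>_. 0)"
proof
  fix xs
  show "coboundary G (Suc n) (coboundary G n f) xs = 0"
  proof (cases "xs \<in> tuples G (Suc (Suc n))")
    case True
    have "bd (coboundary G n f) xs = bd (bd f) xs"
      by (rule bd_cong, rule coboundary_eq_bd) (use True in \<open>auto simp: tuples_def\<close>)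
    then show ?thesis using True by (simp add: coboundary_eq_bd bd_bd)
  qed (simp add: coboundary_outside)
qed

text \<open>The entries \<open>x\<close> and \<open>y\<close> are the two places where factors of
  degrees \<open>p\<close> and \<open>q\<close> can meet once one entry of the tuple is
  deleted.\<close>

lemma tuples_split:
  assumes "xs \<in> tuples G (Suc (p + q))"
  shows "\<exists>A x y B. xs = A @ x # y # B \<and> length A = p \<and> length B = q \<and>
    set A \<subseteq> carrier G \<and> x \<in> carrier G \<and> y \<in> carrier G \<and> set B \<subseteq> carrier G"
proof (intro exI conjI)
  have len: "length xs = Suc (Suc (p + q))" and sub: "set xs \<subseteq> carrier G"
    using assms by (auto simp: tuples_def)
  show eq: "xs = take p xs @ xs ! p # xs ! Suc p # drop (Suc (Suc p)) xs"
    using len by (simp add: Cons_nth_drop_Suc)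
  show "length (take p xs) = p" "length (drop (Suc (Suc p)) xs) = q" using len by auto
  show "set (take p xs) \<subseteq> carrier G" "set (drop (Suc (Suc p)) xs) \<subseteq> carrier G"
    using sub set_take_subset[of p xs] set_drop_subset[of "Suc (Suc p)" xs] by auto
  show "xs ! p \<in> carrier G" "xs ! Suc p \<in> carrier G"
    using sub len nth_mem[of p xs] nth_mem[of "Suc p" xs] by auto
qed

section \<open>Cup products of cochains and the Leibniz rule\<close>

lemma cup_outside: "xs \<notin> tuples G (p + q) \<Longrightarrow> cup G p q f g xs = 0"
  by (simp add: cup_def)

lemma cup_add_left: "cup G p q (\<lambda>xs. f xs + f' xs) g xs = cup G p q f g xs + cup G p q f' g xs"
  by (simp add: cup_def algebra_simps)

lemma cup_diff_left: "cup G p q (\<lambda>xs. f xs - f' xs) g xs = cup G p q f g xs - cup G p q f' g xs"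
  by (simp add: cup_def algebra_simps)

lemma cup_mult_left: "cup G p q (\<lambda>xs. c * f xs) g xs = c * cup G p q f g xs"
  by (simp add: cup_def)

lemma cup_add_right: "cup G p q f (\<lambda>xs. g xs + g' xs) xs = cup G p q f g xs + cup G p q f g' xs"
  by (simp add: cup_def algebra_simps)

lemma cup_zero_left: "cup G p q (\<lambda>_. 0) g = (\<lambda>_. 0)"
  by (simp add: cup_def fun_eq_iff)

lemma cup_zero_right: "cup G p q f (\<lambda>_. 0) = (\<lambda>_. 0)"
  by (simp add: cup_def fun_eq_iff)

lemma take_tuples: "xs \<in> tuples G n \<Longrightarrow> p \<le> n \<Longrightarrow> take (Suc p) xs \<in> tuples G p"
  using set_take_subset[of "Suc p" xs] by (auto simp: tuples_def min_def)

lemma drop_tuples: "xs \<in> tuples G (p + q) \<Longrightarrow> drop p xs \<in> tuples G q"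
  using set_drop_subset[of p xs] by (auto simp: tuples_def)

lemma cup_assoc: "cup G (p + q) r (cup G p q f g) h = cup G p (q + r) f (cup G q r g h)"
proof
  fix xs
  show "cup G (p + q) r (cup G p q f g) h xs = cup G p (q + r) f (cup G q r g h) xs"
  proof (cases "xs \<in> tuples G (p + q + r)")
    case True
    then have "take (Suc (p + q)) xs \<in> tuples G (p + q)" "drop p xs \<in> tuples G (q + r)"
      using take_tuples[of xs G "p + q + r" "p + q"] drop_tuples[of xs G p "q + r"]
      by (simp_all add: add.assoc)
    then show ?thesis using True
      by (simp add: cup_def add.assoc drop_take) (simp add: add.commute)
  qed (simp add: cup_def add.assoc)
qed

text \<open>Deleting \<open>y\<close> in the first product and \<open>x\<close> in the second both
  yield \<open>f (A @ [x]) * g (y # B)\<close>, with opposite signs. The remaining terms match the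
  faces of the cup product one to one.\<close>

lemma coboundary_cup:
  "coboundary G (p + q) (cup G p q f g) xs =
     cup G (Suc p) q (coboundary G p f) g xs + (-1) ^ p * cup G p (Suc q) f (coboundary G q g) xs"
proof (cases "xs \<in> tuples G (Suc (p + q))")
  case True
  then obtain A x y B where xs: "xs = A @ x # y # B" and len: "length A = p" "length B = q"
    and sub: "set A \<subseteq> carrier G" "x \<in> carrier G" "y \<in> carrier G" "set B \<subseteq> carrier G"
    using tuples_split by blast
  have "coboundary G (p + q) (cup G p q f g) xs = bd (\<lambda>zs. f (take (Suc p) zs) * g (drop p zs)) xs"
    unfolding coboundary_eq_bd[OF True]
    by (rule bd_cong) (use True in \<open>auto simp: cup_def tuples_def\<close>)
  also have "\<dots> = bd (\<lambda>zs. f (take (Suc p) (zs @ x # y # B)) * g (drop p (zs @ x # y # B))) A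
      + (-1) ^ p * (f (A @ [y]) * g (y # B) - bd (\<lambda>zs. f (A @ [x]) * g (x # zs)) (y # B))"
    unfolding xs bd_append using len by simp
  \<comment> \<open>After a deletion in \<open>A\<close> the factors meet at \<open>y\<close>; a
    deletion in \<open>y # B\<close> leaves the junction at \<open>x\<close> unless \<open>x\<close>
    is the entry deleted.\<close>
  also have "bd (\<lambda>zs. f (take (Suc p) (zs @ x # y # B)) * g (drop p (zs @ x # y # B))) A
     = bd (\<lambda>zs. f (zs @ [x, y]) * g (y # B)) A"
  proof (rule bd_cong)
    fix zs :: "'a list" assume "Suc (length zs) = length A"
    then have "p = Suc (length zs)" using len by simp
    then show "f (take (Suc p) (zs @ x # y # B)) * g (drop p (zs @ x # y # B)) = f (zs @ [x, y]) * g (y # B)"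
      by simp
  qed
  finally have 1: "coboundary G (p + q) (cup G p q f g) xs =
      bd (\<lambda>zs. f (zs @ [x, y])) A * g (y # B)
      + (-1) ^ p * (f (A @ [y]) * g (y # B) - f (A @ [x]) * bd (\<lambda>zs. g (x # zs)) (y # B))"
    by (simp only: bd_mult_left bd_mult_right)
  have "take (Suc (Suc p)) xs \<in> tuples G (Suc p)" "drop p xs \<in> tuples G (Suc q)"
    using xs len sub by (auto simp: tuples_def)
  then have 2: "cup G (Suc p) q (coboundary G p f) g xs = bd f (A @ [x, y]) * g (y # B)"
    "cup G p (Suc q) f (coboundary G q g) xs = f (A @ [x]) * bd g (x # y # B)"
    using True xs len by (auto simp: cup_def coboundary_eq_bd)
  show ?thesis
    unfolding 1 2 bd_append using len by (simp add: algebra_simps)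
qed (simp add: cup_def coboundary_outside)

section \<open>Bounded invariant cochains\<close>

lemma bounded_cochainsI:
  assumes "\<And>xs. xs \<notin> tuples G n \<Longrightarrow> f xs = 0" "\<And>xs. xs \<in> tuples G n \<Longrightarrow> \<bar>f xs\<bar> \<le> C"
    "\<And>g xs. g \<in> carrier G \<Longrightarrow> xs \<in> tuples G n \<Longrightarrow> f (map (\<lambda>x. g \<otimes>\<^bsub>G\<^esub> x) xs) = f xs"
  shows "f \<in> bounded_cochains G n"
  using assms unfolding bounded_cochains_def by blast

lemma bounded_cochains_outside: "f \<in> bounded_cochains G n \<Longrightarrow> xs \<notin> tuples G n \<Longrightarrow> f xs = 0"
  by (simp add: bounded_cochains_def)

lemma bounded_cochains_invariant:
  "f \<in> bounded_cochains G n \<Longrightarrow> g \<in> carrier G \<Longrightarrow> xs \<in> tuples G n \<Longrightarrow>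
    f (map (\<lambda>x. g \<otimes>\<^bsub>G\<^esub> x) xs) = f xs"
  by (simp add: bounded_cochains_def)

lemma bounded_cochains_bound:
  assumes "f \<in> bounded_cochains G n"
  shows "\<exists>C \<ge> 0. \<forall>xs. \<bar>f xs\<bar> \<le> C"
proof -
  obtain C where C: "\<forall>xs \<in> tuples G n. \<bar>f xs\<bar> \<le> C"
    using assms by (auto simp: bounded_cochains_def)
  show ?thesis
  proof (intro exI[of _ "max C 0"] conjI allI)
    show "max C 0 \<ge> 0" by simp
    show "\<bar>f xs\<bar> \<le> max C 0" for xs
      by (cases "xs \<in> tuples G n") (use C bounded_cochains_outside[OF assms, of xs] in auto)
  qed
qed

context group
begin

lemma map_mult_tuples: "g \<in> carrier G \<Longrightarrow> xs \<in> tuples G n \<Longrightarrow> map (\<lambda>x. g \<otimes> x) xs \<in> tuples G n"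
  by (auto simp: tuples_def)

lemma coboundary_invariant:
  assumes "\<And>zs. zs \<in> tuples G n \<Longrightarrow> f (map (\<lambda>x. g \<otimes> x) zs) = f zs"
    and g: "g \<in> carrier G" and xs: "xs \<in> tuples G (Suc n)"
  shows "coboundary G n f (map (\<lambda>x. g \<otimes> x) xs) = coboundary G n f xs"
  unfolding coboundary_eq_bd[OF xs] coboundary_eq_bd[OF map_mult_tuples[OF g xs]] bd_map
  by (rule bd_cong) (use xs assms(1) in \<open>auto simp: tuples_def\<close>)

lemma coboundary_bounded:
  assumes f: "f \<in> bounded_cochains G n"
  shows "coboundary G n f \<in> bounded_cochains G (Suc n)"
proof -
  obtain C where C: "\<And>xs. \<bar>f xs\<bar> \<le> C" using bounded_cochains_bound[OF f] by blast
  show ?thesis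
  proof (rule bounded_cochainsI)
    fix xs assume xs: "xs \<in> tuples G (Suc n)"
    then show "\<bar>coboundary G n f xs\<bar> \<le> real (Suc (Suc n)) * C"
      using bd_abs_le[of xs f C] C by (simp add: coboundary_eq_bd tuples_def)
  qed (use coboundary_invariant bounded_cochains_invariant[OF f] in \<open>auto simp: coboundary_outside\<close>)
qed

lemma cup_bounded:
  assumes f: "f \<in> bounded_cochains G p" and g: "g \<in> bounded_cochains G q"
  shows "cup G p q f g \<in> bounded_cochains G (p + q)"
proof -
  obtain C where C: "C \<ge> 0" "\<And>xs. \<bar>f xs\<bar> \<le> C" using bounded_cochains_bound[OF f] by blast
  obtain D where D: "\<And>xs. \<bar>g xs\<bar> \<le> D" using bounded_cochains_bound[OF g] by blast
  show ?thesis
  proof (rule bounded_cochainsI)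
    show "\<bar>cup G p q f g xs\<bar> \<le> C * D" if "xs \<in> tuples G (p + q)" for xs
      using that C D by (auto simp: cup_def abs_mult intro!: mult_mono)
  next
    fix a xs assume a: "a \<in> carrier G" and xs: "xs \<in> tuples G (p + q)"
    have "take (Suc p) xs \<in> tuples G p" "drop p xs \<in> tuples G q"
      using xs by (auto intro: drop_tuples take_tuples)
    then show "cup G p q f g (map (\<lambda>x. a \<otimes> x) xs) = cup G p q f g xs"
      using a xs map_mult_tuples[OF a xs] bounded_cochains_invariant[OF f] bounded_cochains_invariant[OF g]
      by (simp add: cup_def take_map drop_map)
  qed (simp add: cup_outside)
qed

lemma bounded_cochains_zero: "(\<lambda>_. 0) \<in> bounded_cochains G n"
  by (simp add: bounded_cochains_def) blast

lemma bounded_cochains_mult: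
  assumes f: "f \<in> bounded_cochains G n"
  shows "(\<lambda>xs. c * f xs) \<in> bounded_cochains G n"
proof -
  obtain C where C: "\<And>xs. \<bar>f xs\<bar> \<le> C" using bounded_cochains_bound[OF f] by blast
  show ?thesis
    by (rule bounded_cochainsI[where C = "\<bar>c\<bar> * C"])
       (use C in \<open>auto simp: bounded_cochains_outside[OF f] bounded_cochains_invariant[OF f] abs_mult
          intro!: mult_left_mono\<close>)
qed

lemma bounded_cochains_diff:
  assumes f: "f \<in> bounded_cochains G n" and g: "g \<in> bounded_cochains G n"
  shows "(\<lambda>xs. f xs - g xs) \<in> bounded_cochains G n"
proof -
  obtain C where C: "\<And>xs. \<bar>f xs\<bar> \<le> C" using bounded_cochains_bound[OF f] by blast
  obtain D where D: "\<And>xs. \<bar>g xs\<bar> \<le> D" using bounded_cochains_bound[OF g] by blast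
  show ?thesis
  proof (rule bounded_cochainsI)
    show "\<bar>f xs - g xs\<bar> \<le> C + D" for xs using C[of xs] D[of xs] by linarith
  qed (use bounded_cochains_outside[OF f] bounded_cochains_outside[OF g] 
        bounded_cochains_invariant[OF f] bounded_cochains_invariant[OF g] in auto)
qed

lemma bounded_cochains_add:
  assumes "f \<in> bounded_cochains G n" and "g \<in> bounded_cochains G n"
  shows "(\<lambda>xs. f xs + g xs) \<in> bounded_cochains G n"
  using bounded_cochains_diff[OF assms(1) bounded_cochains_mult[OF assms(2), of "-1"]] by simp

section \<open>Bounded coboundaries and cohomology classes\<close>

lemma bounded_coboundaries_diff:
  assumes "f \<in> bounded_coboundaries G n" "g \<in> bounded_coboundaries G n"
  shows "(\<lambda>xs. f xs - g xs) \<in> bounded_coboundaries G n"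
proof (cases n)
  case 0
  then show ?thesis using assms by (simp add: bounded_coboundaries_def)
next
  case (Suc m)
  then obtain b c where "f = coboundary G m b" "g = coboundary G m c"
    "b \<in> bounded_cochains G m" "c \<in> bounded_cochains G m"
    using assms by (auto simp: bounded_coboundaries_def)
  then show ?thesis
    using Suc bounded_cochains_diff[of b m c]
    by (auto simp: bounded_coboundaries_def coboundary_diff[symmetric] intro!: image_eqI)
qed

lemma zero_bounded_coboundary: "(\<lambda>_. 0) \<in> bounded_coboundaries G n"
  using image_eqI[of "\<lambda>_. 0" "coboundary G _", OF coboundary_zero[symmetric] bounded_cochains_zero]
  by (auto simp: bounded_coboundaries_def split: nat.split)

lemma bounded_cocycles_zero: "(\<lambda>_. 0) \<in> bounded_cocycles G n"
  by (simp add: bounded_cocycles_def bounded_cochains_zero coboundary_zero)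

lemma coboundary_bounded_cocycle:
  "b \<in> bounded_cochains G n \<Longrightarrow> coboundary G n b \<in> bounded_cocycles G (Suc n)"
  by (simp add: bounded_cocycles_def coboundary_bounded coboundary_coboundary)

text \<open>Subtracting a fixed coboundary does not affect whether a cochain is a coboundary, so
  both classes are the same set of cocycles.\<close>

lemma Hb_class_coboundary:
  assumes b: "b \<in> bounded_cochains G n"
  shows "Hb_class G (Suc n) (coboundary G n b) = Hb_zero G (Suc n)"
proof -
  let ?d = "coboundary G n b"
  have d: "?d \<in> bounded_coboundaries G (Suc n)" using b by (simp add: bounded_coboundaries_def)
  have "(\<lambda>xs. f xs - ?d xs) \<in> bounded_coboundaries G (Suc n) \<longleftrightarrow> f \<in> bounded_coboundaries G (Suc n)" for f
  proof
    assume "(\<lambda>xs. f xs - ?d xs) \<in> bounded_coboundaries G (Suc n)"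
    \<comment> \<open>Closure under differences suffices: \<open>f\<close> is
      \<open>(f - ?d) - (0 - ?d)\<close>.\<close>
    from bounded_coboundaries_diff[OF this
        bounded_coboundaries_diff[OF zero_bounded_coboundary d]]
    show "f \<in> bounded_coboundaries G (Suc n)" by simp
  qed (rule bounded_coboundaries_diff[OF _ d])
  then show ?thesis
    using coboundary_bounded_cocycle[OF b] bounded_cocycles_zero[of "Suc n"]
    by (auto simp: Hb_zero_def Hb_class_def cohomologous_def)
qed

lemma Hb_class_self: "f \<in> bounded_cocycles G n \<Longrightarrow> f \<in> Hb_class G n f"
  using zero_bounded_coboundary by (simp add: Hb_class_def cohomologous_def)

text \<open>Needed because \<open>Hb_cup\<close> is a union over representatives: for an empty
  factor it would be empty instead of the zero class.\<close>

lemma Hb_nonempty: "A \<in> Hb G n \<Longrightarrow> \<exists>f. f \<in> A"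
  using Hb_class_self by (auto simp: Hb_def quotient_def Hb_class_def)

lemma Hb_subset: "A \<in> Hb G n \<Longrightarrow> A \<subseteq> bounded_cocycles G n"
  by (auto simp: Hb_def quotient_def cohomologous_def)

end

section \<open>Equivariant quasi-additive families\<close>

text \<open>Isolates what the cohomological argument uses of the Cayley tree.
  \<open>\<Phi> h a b\<close> acts as an integral of \<open>h\<close> along the segment from
  \<open>a\<close> to \<open>b\<close>. The constant \<open>K\<close> is uniform in \<open>h\<close>
  because the integrand will depend on the other entries of a tuple.\<close>

locale equivariant_quasi_additive = group G for G (structure) +
  fixes \<Phi> :: "('a \<Rightarrow> real) \<Rightarrow> 'a \<Rightarrow> 'a \<Rightarrow> real" and \<phi> :: "'a \<Rightarrow> real"
  assumes add: "\<Phi> (\<lambda>x. h x + k x) a b = \<Phi> h a b + \<Phi> k a b"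
    and mult_left: "\<Phi> (\<lambda>x. c * h x) a b = c * \<Phi> h a b"
    and cong: "\<lbrakk>a \<in> carrier G; b \<in> carrier G; \<And>x. x \<in> carrier G \<Longrightarrow> h x = k x\<rbrakk> \<Longrightarrow> \<Phi> h a b = \<Phi> k a b"
    and equivariant: "\<lbrakk>g \<in> carrier G; a \<in> carrier G; b \<in> carrier G\<rbrakk> \<Longrightarrow>
      \<Phi> h (g \<otimes> a) (g \<otimes> b) = \<Phi> (\<lambda>x. h (g \<otimes> x)) a b"
    and quasi_additive: "\<exists>K \<ge> 0. \<forall>h. \<forall>C \<ge> 0. \<forall>a \<in> carrier G. \<forall>b \<in> carrier G. \<forall>c \<in> carrier G.
      (\<forall>x \<in> carrier G. \<bar>h x\<bar> \<le> C) \<longrightarrow> \<bar>\<Phi> h b c - \<Phi> h a c + \<Phi> h a b\<bar> \<le> K * C"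
    and \<phi>_eq: "g \<in> carrier G \<Longrightarrow> \<phi> g = \<Phi> (\<lambda>_. 1) \<one> g"
begin

lemma mult_right: "\<Phi> (\<lambda>x. h x * c) a b = \<Phi> h a b * c"
  using mult_left[of c h a b] by (simp add: mult.commute)

lemma diff: "\<Phi> (\<lambda>x. h x - k x) a b = \<Phi> h a b - \<Phi> k a b"
  using add[of h "\<lambda>x. (-1) * k x" a b] mult_left[of "-1" k a b] by simp

lemma \<phi>_inv_mult:
  assumes "a \<in> carrier G" "b \<in> carrier G"
  shows "\<phi> (inv a \<otimes> b) = \<Phi> (\<lambda>_. 1) a b"
  using equivariant[of "inv a" a b "\<lambda>_. 1"] assms by (simp add: \<phi>_eq)

section \<open>Integration over the junction of two cochains\<close>

definition defect :: "('a \<Rightarrow> real) \<Rightarrow> 'a \<Rightarrow> 'a \<Rightarrow> 'a \<Rightarrow> real" where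
  "defect h a b c = \<Phi> h b c - \<Phi> h a c + \<Phi> h a b"

text \<open>
  Integrates over the pair of neighbouring entries at which a cochain of degree \<open>p + 1\<close> and one
  of degree \<open>q + 1\<close> are joined; the integration variable is inserted between the two.
\<close>

definition insertion :: "nat \<Rightarrow> nat \<Rightarrow> ('a list \<Rightarrow> real) \<Rightarrow> ('a list \<Rightarrow> real) \<Rightarrow> 'a list \<Rightarrow> real" where
  "insertion p q f g = (\<lambda>xs. if xs \<in> tuples G (Suc (p + q))
     then \<Phi> (\<lambda>x. f (take (Suc p) xs @ [x]) * g (x # drop (Suc p) xs)) (xs ! p) (xs ! Suc p) else 0)"

text \<open>The \<open>\<Xi>\<close> of the overview. The entry at position \<open>Suc p\<close>
  serves only as the middle vertex of the triangle; both factors skip it, so one integrand is shared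
  by all three sides.\<close>

definition defect_product :: "nat \<Rightarrow> nat \<Rightarrow> ('a list \<Rightarrow> real) \<Rightarrow> ('a list \<Rightarrow> real) \<Rightarrow> 'a list \<Rightarrow> real" where
  "defect_product p q f g = (\<lambda>xs. if xs \<in> tuples G (Suc (Suc (p + q)))
     then defect (\<lambda>x. f (take (Suc p) xs @ [x]) * g (x # drop (Suc (Suc p)) xs))
       (xs ! p) (xs ! Suc p) (xs ! Suc (Suc p)) else 0)"

text \<open>As a factor of \<open>insertion\<close> it makes the other cochain be integrated alone.
  It is not a cocycle, since on triples \<open>1 - 1 + 1 = 1\<close>.\<close>

definition const_one :: "'a list \<Rightarrow> real" where
  "const_one xs = (if xs \<in> tuples G 1 then 1 else 0)"

text \<open>Linearity moves the alternating sum under the integral. The endpoints stay fixed, so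
  this covers only deletions that do not change the segment of integration.\<close>

lemma bd_\<Phi>: "bd (\<lambda>zs. \<Phi> (\<lambda>x. h x zs) a b) xs = \<Phi> (\<lambda>x. bd (h x) xs) a b"
proof (induction xs arbitrary: h)
  case Nil
  show ?case using mult_left[of 0 "\<lambda>_. 0" a b] by simp
qed (simp add: diff)

text \<open>Whichever entry of \<open>A\<close> is deleted, \<open>y\<close> and \<open>hd B\<close>
  move into positions \<open>p\<close> and \<open>Suc p\<close>, so all these faces integrate over
  the same segment. Deletions in \<open>B\<close> likewise always leave the segment from
  \<open>last A\<close> to \<open>y\<close>.\<close>

lemma bd_insertion_left:
  assumes "length A = Suc p" "length B = Suc q" "set (A @ y # B) \<subseteq> carrier G"
  shows "bd (\<lambda>zs. insertion p q f g (zs @ y # B)) A =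
    \<Phi> (\<lambda>x. bd (\<lambda>zs. f (zs @ [y, x])) A * g (x # B)) y (hd B)"
proof -
  have "bd (\<lambda>zs. insertion p q f g (zs @ y # B)) A =
      bd (\<lambda>zs. \<Phi> (\<lambda>x. f (zs @ [y, x]) * g (x # B)) y (hd B)) A"
  proof (rule bd_cong)
    fix zs assume zs: "Suc (length zs) = length A" "set zs \<subseteq> set A"
    then have p: "p = length zs" using assms by simp
    have "zs @ y # B \<in> tuples G (Suc (p + q))" using assms zs by (auto simp: tuples_def)
    moreover have "B \<noteq> []" using assms by auto
    ultimately show "insertion p q f g (zs @ y # B) = \<Phi> (\<lambda>x. f (zs @ [y, x]) * g (x # B)) y (hd B)"
      by (simp add: insertion_def p nth_append hd_conv_nth)
  qed
  then show ?thesis by (simp only: bd_\<Phi> bd_mult_right)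
qed

lemma bd_insertion_right:
  assumes "length A = Suc p" "length B = Suc q" "set (A @ y # B) \<subseteq> carrier G"
  shows "bd (\<lambda>zs. insertion p q f g (A @ y # zs)) B =
    \<Phi> (\<lambda>x. f (A @ [x]) * bd (\<lambda>zs. g (x # y # zs)) B) (last A) y"
proof -
  have "bd (\<lambda>zs. insertion p q f g (A @ y # zs)) B =
      bd (\<lambda>zs. \<Phi> (\<lambda>x. f (A @ [x]) * g (x # y # zs)) (last A) y) B"
  proof (rule bd_cong)
    fix zs assume zs: "Suc (length zs) = length B" "set zs \<subseteq> set B"
    have "A @ y # zs \<in> tuples G (Suc (p + q))" using assms zs by (auto simp: tuples_def)
    moreover have "A \<noteq> []" using assms by auto
    ultimately show "insertion p q f g (A @ y # zs) = \<Phi> (\<lambda>x. f (A @ [x]) * g (x # y # zs)) (last A) y"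
      using assms by (simp add: insertion_def nth_append last_conv_nth)
  qed
  then show ?thesis by (simp only: bd_\<Phi> bd_mult_left)
qed

lemma insertion_const_one_left:
  assumes "length B = Suc q" "set (y # B) \<subseteq> carrier G"
  shows "insertion 0 q const_one g (y # B) = \<Phi> (\<lambda>x. g (x # B)) y (hd B)"
proof -
  have "hd B \<in> carrier G" "B \<noteq> []" using assms by (cases B; auto)+
  then have "\<Phi> (\<lambda>x. const_one [y, x] * g (x # B)) y (hd B) = \<Phi> (\<lambda>x. g (x # B)) y (hd B)"
    by (intro cong) (use assms in \<open>auto simp: const_one_def tuples_def\<close>)
  then show ?thesis
    using assms \<open>B \<noteq> []\<close> by (simp add: insertion_def tuples_def hd_conv_nth)
qed

lemma insertion_const_one_right:
  assumes "length A = Suc p" "set (A @ [y]) \<subseteq> carrier G"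
  shows "insertion p 0 f const_one (A @ [y]) = \<Phi> (\<lambda>x. f (A @ [x])) (last A) y"
proof -
  have "A \<noteq> []" using assms by auto
  then have "last A \<in> carrier G" using assms last_in_set[of A] by auto
  then have "\<Phi> (\<lambda>x. f (A @ [x]) * const_one [x, y]) (last A) y = \<Phi> (\<lambda>x. f (A @ [x])) (last A) y"
    by (intro cong) (use assms in \<open>auto simp: const_one_def tuples_def\<close>)
  then show ?thesis
    using assms \<open>A \<noteq> []\<close> by (simp add: insertion_def tuples_def last_conv_nth nth_append)
qed

text \<open>Deleting from \<open>A\<close>, deleting \<open>y\<close> and deleting from
  \<open>B\<close> give integrals over the three sides of the triangle \<open>last A\<close>,
  \<open>y\<close>, \<open>hd B\<close>. Expanding the coboundaries of \<open>f\<close> and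
  \<open>g\<close> replaces the integrands on the two outer sides by the common one, which produces
  the defect, and by terms with one factor free of \<open>x\<close>, which produce the two cup
  products.\<close>

lemma coboundary_insertion:
  "coboundary G (Suc (p + q)) (insertion p q f g) xs =
     insertion (Suc p) q (coboundary G (Suc p) f) g xs
     + (-1) ^ p * insertion p (Suc q) f (coboundary G (Suc q) g) xs
     - (-1) ^ p * (cup G (Suc p) (Suc q) f (insertion 0 q const_one g) xs
         + cup G (Suc p) (Suc q) (insertion p 0 f const_one) g xs - defect_product p q f g xs)"
proof (cases "xs \<in> tuples G (Suc (Suc (p + q)))")
  case True
  define A y B where "A = take (Suc p) xs" and "y = xs ! Suc p" and "B = drop (Suc (Suc p)) xs"
  have len: "length xs = p + q + 3" and sub: "set xs \<subseteq> carrier G"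
    using True by (auto simp: tuples_def)
  have xs: "xs = A @ y # B"
    using len by (simp add: A_def y_def B_def id_take_nth_drop)
  have lenA: "length A = Suc p" and lenB: "length B = Suc q"
    using len by (simp_all add: A_def B_def)
  have nth: "xs ! p = last A" "xs ! Suc p = y" "xs ! Suc (Suc p) = hd B"
    using lenA lenB by (cases A rule: rev_cases; cases B; simp add: xs nth_append)+
  have parts: "take (Suc p) xs = A" "drop (Suc p) xs = y # B" "take (Suc (Suc p)) xs = A @ [y]"
    "drop (Suc (Suc p)) xs = B"
    using lenA by (simp_all add: xs)
  have sub': "set (A @ y # B) \<subseteq> carrier G" using sub xs by simp
  have car: "last A \<in> carrier G" "y \<in> carrier G" "hd B \<in> carrier G"
    using sub' lenA lenB by (cases A rule: rev_cases; cases B; simp)+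
  have tup: "A @ y # B \<in> tuples G (Suc (Suc (p + q)))" using True xs by simp
  have AB: "A @ B \<in> tuples G (Suc (p + q))" using lenA lenB sub' by (auto simp: tuples_def)
  have "coboundary G (Suc (p + q)) (insertion p q f g) xs =
     bd (\<lambda>zs. insertion p q f g (zs @ y # B)) A +
     (-1) ^ Suc p * (insertion p q f g (A @ B) - bd (\<lambda>zs. insertion p q f g (A @ y # zs)) B)"
    unfolding coboundary_eq_bd[OF True] unfolding xs bd_append using lenA by simp
  moreover have "insertion p q f g (A @ B) = \<Phi> (\<lambda>x. f (A @ [x]) * g (x # B)) (last A) (hd B)"
    using AB lenA lenB
    by (cases A rule: rev_cases; cases B; simp add: insertion_def nth_append)
  ultimately have 1: "coboundary G (Suc (p + q)) (insertion p q f g) xs =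
     \<Phi> (\<lambda>x. bd (\<lambda>zs. f (zs @ [y, x])) A * g (x # B)) y (hd B) -
     (-1) ^ p * (\<Phi> (\<lambda>x. f (A @ [x]) * g (x # B)) (last A) (hd B) -
       \<Phi> (\<lambda>x. f (A @ [x]) * bd (\<lambda>zs. g (x # y # zs)) B) (last A) y)"
    using bd_insertion_left[OF lenA lenB sub'] bd_insertion_right[OF lenA lenB sub'] by simp
  have "insertion (Suc p) q (coboundary G (Suc p) f) g xs =
     \<Phi> (\<lambda>x. coboundary G (Suc p) f (A @ [y, x]) * g (x # B)) y (hd B)"
    using True by (simp add: insertion_def parts nth)
  \<comment> \<open>Deleting \<open>y\<close> from \<open>A @ [y, x]\<close> gives the common
    integrand of the triangle; deleting \<open>x\<close> gives \<open>f (A @ [y])\<close>, which is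
    constant and leaves the integral.\<close>
  also have "\<dots> = \<Phi> (\<lambda>x. bd (\<lambda>zs. f (zs @ [y, x])) A * g (x # B)
      - (-1) ^ p * (f (A @ [x]) * g (x # B)) + (-1) ^ p * f (A @ [y]) * g (x # B)) y (hd B)"
  proof (intro cong car)
    fix x assume "x \<in> carrier G"
    then have "A @ [y, x] \<in> tuples G (Suc (Suc p))" using lenA sub' by (auto simp: tuples_def)
    then show "coboundary G (Suc p) f (A @ [y, x]) * g (x # B) = bd (\<lambda>zs. f (zs @ [y, x])) A * g (x # B)
      - (-1) ^ p * (f (A @ [x]) * g (x # B)) + (-1) ^ p * f (A @ [y]) * g (x # B)"
      using lenA by (simp add: coboundary_eq_bd bd_append algebra_simps)
  qed
  also have "\<dots> = \<Phi> (\<lambda>x. bd (\<lambda>zs. f (zs @ [y, x])) A * g (x # B)) y (hd B)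
      - (-1) ^ p * \<Phi> (\<lambda>x. f (A @ [x]) * g (x # B)) y (hd B)
      + (-1) ^ p * (f (A @ [y]) * \<Phi> (\<lambda>x. g (x # B)) y (hd B))"
    by (simp only: add diff mult_left mult.assoc)
  finally have 2: "insertion (Suc p) q (coboundary G (Suc p) f) g xs = \<dots>" .
  have "insertion p (Suc q) f (coboundary G (Suc q) g) xs =
     \<Phi> (\<lambda>x. f (A @ [x]) * coboundary G (Suc q) g (x # y # B)) (last A) y"
    using True by (simp add: insertion_def parts nth)
  \<comment> \<open>The mirror image: deleting \<open>y\<close> from \<open>x # y # B\<close> gives
    the common integrand, deleting \<open>x\<close> the constant \<open>g (y # B)\<close>.\<close>
  also have "\<dots> = \<Phi> (\<lambda>x. f (A @ [x]) * bd (\<lambda>zs. g (x # y # zs)) B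
      - f (A @ [x]) * g (x # B) + f (A @ [x]) * g (y # B)) (last A) y"
  proof (intro cong car)
    fix x assume "x \<in> carrier G"
    then have "x # y # B \<in> tuples G (Suc (Suc q))" using lenB sub' by (auto simp: tuples_def)
    then show "f (A @ [x]) * coboundary G (Suc q) g (x # y # B) = f (A @ [x]) * bd (\<lambda>zs. g (x # y # zs)) B
      - f (A @ [x]) * g (x # B) + f (A @ [x]) * g (y # B)"
      by (simp add: coboundary_eq_bd algebra_simps)
  qed
  also have "\<dots> = \<Phi> (\<lambda>x. f (A @ [x]) * bd (\<lambda>zs. g (x # y # zs)) B) (last A) y
      - \<Phi> (\<lambda>x. f (A @ [x]) * g (x # B)) (last A) y + \<Phi> (\<lambda>x. f (A @ [x])) (last A) y * g (y # B)"
    by (simp only: add diff mult_right)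
  finally have 3: "insertion p (Suc q) f (coboundary G (Suc q) g) xs = \<dots>" .
  have 4: "cup G (Suc p) (Suc q) f (insertion 0 q const_one g) xs =
      f (A @ [y]) * \<Phi> (\<lambda>x. g (x # B)) y (hd B)"
    using True lenB sub' by (simp add: cup_def parts insertion_const_one_left)
  have 5: "cup G (Suc p) (Suc q) (insertion p 0 f const_one) g xs =
      \<Phi> (\<lambda>x. f (A @ [x])) (last A) y * g (y # B)"
    using True lenA sub' by (simp add: cup_def parts insertion_const_one_right)
  have 6: "defect_product p q f g xs = defect (\<lambda>x. f (A @ [x]) * g (x # B)) (last A) y (hd B)"
    using True by (simp add: defect_product_def parts nth)
  show ?thesis
    unfolding 1 2 3 4 5 6 defect_def by (simp add: algebra_simps)
qed (simp add: coboundary_outside insertion_def cup_outside defect_product_def)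

section \<open>The constant one-cochain as a factor\<close>

lemma const_one_bounded: "const_one \<in> bounded_cochains G 1"
  by (rule bounded_cochainsI[where C = 1]) (auto simp: const_one_def map_mult_tuples)

lemma coboundary_const_one: "coboundary G 1 const_one xs = (if xs \<in> tuples G 2 then 1 else 0)"
proof (cases "xs \<in> tuples G 2")
  case True
  then obtain a b c where "xs = [a, b, c]" "{a, b, c} \<subseteq> carrier G"
    by (auto simp: tuples_def numeral_2_eq_2 length_Suc_conv)
  then show ?thesis using True
    by (simp add: coboundary_eq_bd numeral_2_eq_2[symmetric]) (simp add: const_one_def tuples_def)
qed (simp add: coboundary_outside numeral_2_eq_2)

text \<open>The integrand is 1 on the carrier, and equivariance moves the starting point
  \<open>a\<close> to the identity.\<close>

lemma insertion_const_one_const_one: "insertion 0 0 const_one const_one = qm_hat G \<phi>"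
proof
  fix xs
  show "insertion 0 0 const_one const_one xs = qm_hat G \<phi> xs"
  proof (cases "xs \<in> tuples G 1")
    case True
    then obtain a b where xs: "xs = [a, b]" "a \<in> carrier G" "b \<in> carrier G"
      by (auto simp: tuples_def length_Suc_conv)
    have "\<Phi> (\<lambda>x. const_one [x, b]) a b = \<Phi> (\<lambda>_. 1) a b"
      by (rule cong) (use xs in \<open>auto simp: const_one_def tuples_def\<close>)
    then show ?thesis
      using xs True insertion_const_one_left[of "[b]" 0 a const_one]
      by (simp add: qm_hat_def \<phi>_inv_mult)
  qed (simp add: insertion_def qm_hat_def)
qed

lemma insertion_zero_left: "insertion p q (\<lambda>_. 0) g = (\<lambda>_. 0)"
  using mult_left[of 0 "\<lambda>_. 0"] by (simp add: insertion_def fun_eq_iff)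

lemma insertion_zero_right: "insertion p q f (\<lambda>_. 0) = (\<lambda>_. 0)"
  using mult_left[of 0 "\<lambda>_. 0"] by (simp add: insertion_def fun_eq_iff)

text \<open>Both sides integrate \<open>f\<close> alone, as \<open>const_one\<close> and its
  coboundary take the value 1. Thus the term of \<open>coboundary_insertion\<close> that survives
  because \<open>const_one\<close> is not closed cancels one of the two cup products. The left
  version is symmetric.\<close>

lemma insertion_coboundary_const_one_right:
  "insertion p 1 f (coboundary G 1 const_one) = cup G (Suc p) 1 (insertion p 0 f const_one) const_one"
proof
  fix xs
  show "insertion p 1 f (coboundary G 1 const_one) xs =
      cup G (Suc p) 1 (insertion p 0 f const_one) const_one xs"
  proof (cases "xs \<in> tuples G (Suc (p + 1))")
    case True
    then obtain A y b where xs: "xs = A @ [y, b]" "length A = Suc p" "set (A @ [y, b]) \<subseteq> carrier G"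
      using tuples_split[of xs G "Suc p" 0] by fastforce
    then have "last A \<in> carrier G" by (cases A rule: rev_cases) auto
    then have "\<Phi> (\<lambda>x. f (A @ [x]) * coboundary G 1 const_one [x, y, b]) (last A) y
        = \<Phi> (\<lambda>x. f (A @ [x])) (last A) y"
      by (intro cong) (use xs in \<open>auto simp: coboundary_const_one[unfolded One_nat_def] tuples_def\<close>)
    moreover have "const_one [y, b] = 1" using xs by (simp add: const_one_def tuples_def)
    moreover have "(A @ [y, b]) ! p = last A" using xs by (cases A rule: rev_cases) (auto simp: nth_append)
    ultimately show ?thesis
      using True xs insertion_const_one_right[of A p y f] by (simp add: insertion_def[of p "Suc 0"] cup_def nth_append)
  qed (simp add: insertion_def cup_def)
qed

lemma insertion_coboundary_const_one_left:
  "insertion 1 q (coboundary G 1 const_one) g = cup G 1 (Suc q) const_one (insertion 0 q const_one g)"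
proof
  fix xs
  show "insertion 1 q (coboundary G 1 const_one) g xs =
      cup G 1 (Suc q) const_one (insertion 0 q const_one g) xs"
  proof (cases "xs \<in> tuples G (Suc (0 + Suc q))")
    case True
    then obtain a y B where xs: "xs = a # y # B" "length B = Suc q" "set (a # y # B) \<subseteq> carrier G"
      using tuples_split[of xs G 0 "Suc q"] by fastforce
    then have "hd B \<in> carrier G" by (cases B) auto
    then have "\<Phi> (\<lambda>x. coboundary G 1 const_one [a, y, x] * g (x # B)) y (hd B)
        = \<Phi> (\<lambda>x. g (x # B)) y (hd B)"
      by (intro cong) (use xs in \<open>auto simp: coboundary_const_one[unfolded One_nat_def] tuples_def\<close>)
    moreover have "const_one [a, y] = 1" using xs by (simp add: const_one_def tuples_def)
    moreover have "B ! 0 = hd B" using xs by (cases B) auto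
    ultimately show ?thesis
      using True xs insertion_const_one_left[of B q y g] by (simp add: insertion_def[of "Suc 0"] cup_def)
  qed (simp add: insertion_def cup_def)
qed

lemma minus_one_power_square: "(-1 :: real) ^ p * ((-1) ^ p * r) = r"
  by (simp flip: mult.assoc power_mult_distrib)

text \<open>\<open>coboundary_insertion\<close> solved for the defect. The summands on the right may
  be unbounded; boundedness of their sum comes from the left-hand side.\<close>

lemma defect_product_eq:
  assumes "coboundary G (Suc p) f = (\<lambda>_. 0)" "coboundary G (Suc q) g = (\<lambda>_. 0)"
  shows "defect_product p q f g = (\<lambda>xs. cup G (Suc p) (Suc q) f (insertion 0 q const_one g) xs
    + cup G (Suc p) (Suc q) (insertion p 0 f const_one) g xs
    + (-1) ^ p * coboundary G (Suc (p + q)) (insertion p q f g) xs)"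
  by (simp add: coboundary_insertion assms insertion_zero_left insertion_zero_right
      minus_one_power_square fun_eq_iff)

text \<open>Exhibits \<open>f \<union> qm_hat\<close> as bounded up to the coboundary of a possibly
  unbounded cochain; applying the coboundary then gives a bounded primitive of
  \<open>f \<union> \<psi>\<close>, up to sign.\<close>

lemma defect_product_const_one_right:
  assumes "coboundary G (Suc p) f = (\<lambda>_. 0)"
  shows "defect_product p 0 f const_one = (\<lambda>xs. cup G (Suc p) 1 f (qm_hat G \<phi>) xs
    + (-1) ^ p * coboundary G (Suc p) (insertion p 0 f const_one) xs)"
proof
  fix xs
  let ?d = "coboundary G (Suc p) (insertion p 0 f const_one) xs"
    and ?c = "cup G (Suc p) 1 f (qm_hat G \<phi>) xs"
  have "(-1) ^ p * defect_product p 0 f const_one xs = ?d + (-1) ^ p * ?c"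
    using coboundary_insertion[of p 0 f const_one xs] insertion_coboundary_const_one_right[of p f]
    by (simp add: assms insertion_zero_left insertion_const_one_const_one algebra_simps)
  then have "(-1) ^ p * ((-1) ^ p * defect_product p 0 f const_one xs) = (-1) ^ p * (?d + (-1) ^ p * ?c)"
    by simp
  then show "defect_product p 0 f const_one xs = ?c + (-1) ^ p * ?d"
    by (simp only: distrib_left minus_one_power_square)
qed

lemma defect_product_const_one_left:
  assumes "coboundary G (Suc q) g = (\<lambda>_. 0)"
  shows "defect_product 0 q const_one g = (\<lambda>xs. cup G 1 (Suc q) (qm_hat G \<phi>) g xs
    + coboundary G (Suc q) (insertion 0 q const_one g) xs)"
proof
  fix xs
  show "defect_product 0 q const_one g xs = cup G 1 (Suc q) (qm_hat G \<phi>) g xs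
    + coboundary G (Suc q) (insertion 0 q const_one g) xs"
    using coboundary_insertion[of 0 q const_one g xs] insertion_coboundary_const_one_left[of q g]
    by (simp add: assms insertion_zero_right insertion_const_one_const_one)
qed

section \<open>Boundedness of the triangle defect\<close>

lemma defect_invariant:
  assumes "g \<in> carrier G" "a \<in> carrier G" "b \<in> carrier G" "c \<in> carrier G"
  shows "defect h (g \<otimes> a) (g \<otimes> b) (g \<otimes> c) = defect (\<lambda>x. h (g \<otimes> x)) a b c"
  using assms by (simp add: defect_def equivariant)

lemma defect_cong:
  assumes "a \<in> carrier G" "b \<in> carrier G" "c \<in> carrier G" "\<And>x. x \<in> carrier G \<Longrightarrow> h x = k x"
  shows "defect h a b c = defect k a b c"
  unfolding defect_def using cong[of _ _ h k] assms by simp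

text \<open>The bound is quasi-additivity for an integrand of size at most \<open>C * D\<close>. For
  invariance, a translation of the vertices is passed to the integration variable and then absorbed
  by the invariance of \<open>f\<close> and \<open>g\<close>.\<close>

lemma defect_product_bounded:
  assumes f: "f \<in> bounded_cochains G (Suc p)" and g: "g \<in> bounded_cochains G (Suc q)"
  shows "defect_product p q f g \<in> bounded_cochains G (Suc (Suc (p + q)))"
proof -
  obtain C where C: "C \<ge> 0" "\<And>xs. \<bar>f xs\<bar> \<le> C" using bounded_cochains_bound[OF f] by blast
  obtain D where D: "D \<ge> 0" "\<And>xs. \<bar>g xs\<bar> \<le> D" using bounded_cochains_bound[OF g] by blast
  obtain K where K: "\<And>h C a b c. \<lbrakk>C \<ge> 0; a \<in> carrier G; b \<in> carrier G; c \<in> carrier G;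
      \<forall>x \<in> carrier G. \<bar>h x\<bar> \<le> C\<rbrakk> \<Longrightarrow> \<bar>defect h a b c\<bar> \<le> K * C"
    using quasi_additive unfolding defect_def by blast
  have nth: "xs ! p \<in> carrier G" "xs ! Suc p \<in> carrier G" "xs ! Suc (Suc p) \<in> carrier G"
    if "xs \<in> tuples G (Suc (Suc (p + q)))" for xs
    using that nth_mem[of _ xs] by (auto simp: tuples_def)
  show ?thesis
  proof (rule bounded_cochainsI)
    fix xs assume xs: "xs \<in> tuples G (Suc (Suc (p + q)))"
    then show "\<bar>defect_product p q f g xs\<bar> \<le> K * (C * D)"
      using C D by (auto simp: defect_product_def abs_mult intro!: K nth mult_mono)
  next
    fix a xs assume a: "a \<in> carrier G" and xs: "xs \<in> tuples G (Suc (Suc (p + q)))"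
    let ?A = "take (Suc p) xs" and ?B = "drop (Suc (Suc p)) xs"
    have len: "length xs = p + q + 3" and sub: "set xs \<subseteq> carrier G" using xs by (auto simp: tuples_def)
    have AB: "?A @ [x] \<in> tuples G (Suc p)" "x # ?B \<in> tuples G (Suc q)" if "x \<in> carrier G" for x
      using that len sub set_take_subset[of "Suc p" xs] set_drop_subset[of "Suc (Suc p)" xs]
      by (auto simp: tuples_def)
    have "defect_product p q f g (map (\<lambda>x. a \<otimes> x) xs) =
      defect (\<lambda>x. f (map (\<lambda>x. a \<otimes> x) (?A @ [x])) * g (map (\<lambda>x. a \<otimes> x) (x # ?B)))
        (xs ! p) (xs ! Suc p) (xs ! Suc (Suc p))"
      using map_mult_tuples[OF a xs] a nth[OF xs] len
      by (simp add: defect_product_def take_map drop_map defect_invariant)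
    also have "\<dots> = defect (\<lambda>x. f (?A @ [x]) * g (x # ?B)) (xs ! p) (xs ! Suc p) (xs ! Suc (Suc p))"
      by (intro defect_cong nth xs)
         (simp only: bounded_cochains_invariant[OF f a AB(1)] bounded_cochains_invariant[OF g a AB(2)])
    also have "\<dots> = defect_product p q f g xs" using xs by (simp add: defect_product_def)
    finally show "defect_product p q f g (map (\<lambda>x. a \<otimes> x) xs) = defect_product p q f g xs" .
  qed (simp add: defect_product_def)
qed

text \<open>Quasi-additivity for the constant integrand 1 and the triangle with vertices
  \<open>\<one>\<close>, \<open>g\<close> and \<open>g \<otimes> h\<close>.\<close>

lemma quasimorphism_\<phi>: "quasimorphism G \<phi>"
proof -
  obtain K where K: "\<And>h C a b c. \<lbrakk>C \<ge> 0; a \<in> carrier G; b \<in> carrier G; c \<in> carrier G;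
      \<forall>x \<in> carrier G. \<bar>h x\<bar> \<le> C\<rbrakk> \<Longrightarrow> \<bar>\<Phi> h b c - \<Phi> h a c + \<Phi> h a b\<bar> \<le> K * C"
    using quasi_additive by blast
  have "\<bar>\<phi> g + \<phi> h - \<phi> (g \<otimes> h)\<bar> \<le> K" if "g \<in> carrier G" "h \<in> carrier G" for g h
    using K[of 1 \<one> g "g \<otimes> h" "\<lambda>_. 1"] that \<phi>_inv_mult[of g "g \<otimes> h"]
    by (simp add: \<phi>_eq m_assoc[symmetric] algebra_simps)
  then show ?thesis unfolding quasimorphism_def by blast
qed

definition \<psi> :: "'a list \<Rightarrow> real" where
  "\<psi> = coboundary G 1 (qm_hat G \<phi>)"

text \<open>\<open>qm_hat\<close> may be unbounded, so its coboundary is shown to be bounded by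
  identifying it with a triangle defect: with \<open>const_one\<close> as both factors, the two
  correction terms cancel both cup products.\<close>

lemma \<psi>_cocycle: "\<psi> \<in> bounded_cocycles G 2"
proof -
  have "\<psi> xs = defect_product 0 0 const_one const_one xs" for xs
    using coboundary_insertion[of 0 0 const_one const_one xs] insertion_coboundary_const_one_left[of 0 const_one]
      insertion_coboundary_const_one_right[of 0 const_one]
    by (simp add: \<psi>_def insertion_const_one_const_one)
  then have "\<psi> = defect_product 0 0 const_one const_one" ..
  then have "\<psi> \<in> bounded_cochains G (Suc (Suc 0))"
    using defect_product_bounded[of const_one 0 const_one 0] const_one_bounded by simp
  then show ?thesis
    using coboundary_coboundary[of G 1 "qm_hat G \<phi>"]
    by (simp add: bounded_cocycles_def \<psi>_def numeral_2_eq_2)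
qed

text \<open>The defect differs from \<open>f \<union> qm_hat\<close> by an exact cochain, and the
  Leibniz rule passes the coboundary across \<open>f\<close>, of degree \<open>Suc p\<close>, whence
  the sign.\<close>

lemma coboundary_defect_product_right:
  assumes "coboundary G (Suc p) f = (\<lambda>_. 0)"
  shows "coboundary G (Suc (Suc p)) (defect_product p 0 f const_one) =
    (\<lambda>xs. - ((-1) ^ p) * cup G (Suc p) 2 f \<psi> xs)"
proof
  fix xs
  show "coboundary G (Suc (Suc p)) (defect_product p 0 f const_one) xs = - ((-1) ^ p) * cup G (Suc p) 2 f \<psi> xs"
    using coboundary_cup[of G "Suc p" 1 f "qm_hat G \<phi>" xs]
    by (simp add: defect_product_const_one_right[OF assms] coboundary_add coboundary_mult_left
        coboundary_coboundary assms cup_zero_left \<psi>_def numeral_2_eq_2)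
qed

lemma coboundary_defect_product_left:
  assumes "coboundary G (Suc q) g = (\<lambda>_. 0)"
  shows "coboundary G (Suc (Suc q)) (defect_product 0 q const_one g) = cup G 2 (Suc q) \<psi> g"
proof
  fix xs
  show "coboundary G (Suc (Suc q)) (defect_product 0 q const_one g) xs = cup G 2 (Suc q) \<psi> g xs"
    using coboundary_cup[of G 1 "Suc q" "qm_hat G \<phi>" g xs]
    by (simp add: defect_product_const_one_left[OF assms] coboundary_add
        coboundary_coboundary assms cup_zero_right \<psi>_def numeral_2_eq_2)
qed

lemma qm_class_eq: "qm_class G \<phi> = Hb_class G 2 \<psi>"
  by (simp add: qm_class_def \<psi>_def)

lemma \<psi>_in_qm_class: "\<psi> \<in> qm_class G \<phi>"
  by (simp add: qm_class_eq Hb_class_self \<psi>_cocycle)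

lemma qm_classE:
  assumes "u \<in> qm_class G \<phi>"
  shows "\<exists>b \<in> bounded_cochains G 1. u = (\<lambda>xs. \<psi> xs + coboundary G 1 b xs)"
proof -
  have "(\<lambda>xs. u xs - \<psi> xs) \<in> bounded_coboundaries G (Suc 1)"
    using assms by (simp add: qm_class_eq Hb_class_def cohomologous_def numeral_2_eq_2)
  then obtain b where b: "b \<in> bounded_cochains G 1" "(\<lambda>xs. u xs - \<psi> xs) = coboundary G 1 b"
    by (auto simp: bounded_coboundaries_def)
  then have "u = (\<lambda>xs. \<psi> xs + coboundary G 1 b xs)" by (auto simp: fun_eq_iff algebra_simps)
  then show ?thesis using b(1) by blast
qed

section \<open>Vanishing of the cup products and of the Massey product\<close>

lemma cocycle_bounded: "f \<in> bounded_cocycles G n \<Longrightarrow> f \<in> bounded_cochains G n"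
  by (simp add: bounded_cocycles_def)

lemma cocycle_coboundary: "f \<in> bounded_cocycles G n \<Longrightarrow> coboundary G n f = (\<lambda>_. 0)"
  by (simp add: bounded_cocycles_def)

text \<open>\<open>Hb_cup\<close> ranges over all representatives, so
  \<open>u = \<psi> + \<delta>b\<close> must be treated: the defect handles \<open>\<psi>\<close>
  and \<open>f \<union> b\<close> handles \<open>\<delta>b\<close>.\<close>

lemma Hb_cup_qm_class_right:
  assumes \<alpha>: "\<alpha> \<in> Hb G (Suc p)"
  shows "Hb_cup G (Suc p) 2 \<alpha> (qm_class G \<phi>) = Hb_zero G (Suc p + 2)"
proof -
  have "Hb_class G (Suc p + 2) (cup G (Suc p) 2 f u) = Hb_zero G (Suc p + 2)"
    if f: "f \<in> \<alpha>" and u: "u \<in> qm_class G \<phi>" for f u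
  proof -
    have f: "f \<in> bounded_cochains G (Suc p)" "coboundary G (Suc p) f = (\<lambda>_. 0)"
      using f Hb_subset[OF \<alpha>] by (auto simp: cocycle_bounded cocycle_coboundary)
    obtain b where b: "b \<in> bounded_cochains G 1" and u: "u = (\<lambda>xs. \<psi> xs + coboundary G 1 b xs)"
      using qm_classE[OF u] by blast
    \<comment> \<open>The Leibniz sign for a left factor of degree \<open>Suc p\<close>; it is its
      own inverse.\<close>
    define s :: real where "s = - ((-1) ^ p)"
    have s: "s * (s * r) = r" for r using minus_one_power_square[of p r] by (simp add: s_def)
    let ?c = "\<lambda>xs. s * (defect_product p 0 f const_one xs + cup G (Suc p) 1 f b xs)"
    have "defect_product p 0 f const_one \<in> bounded_cochains G (Suc (Suc p))"
      using defect_product_bounded[OF f(1), of const_one 0] const_one_bounded by simp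
    moreover have "cup G (Suc p) 1 f b \<in> bounded_cochains G (Suc (Suc p))"
      using cup_bounded[OF f(1) b] by simp
    ultimately have c: "?c \<in> bounded_cochains G (Suc (Suc p))"
      by (intro bounded_cochains_mult bounded_cochains_add)
    have "coboundary G (Suc (Suc p)) ?c xs = cup G (Suc p) 2 f u xs" for xs
    proof -
      have "coboundary G (Suc (Suc p)) (cup G (Suc p) 1 f b) xs = s * cup G (Suc p) 2 f (coboundary G 1 b) xs"
        using coboundary_cup[of G "Suc p" 1 f b xs]
        by (simp add: f cup_zero_left s_def numeral_2_eq_2)
      moreover have "coboundary G (Suc (Suc p)) (defect_product p 0 f const_one) xs = s * cup G (Suc p) 2 f \<psi> xs"
        by (simp add: coboundary_defect_product_right f s_def)
      ultimately show ?thesis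
        by (simp only: coboundary_mult_left coboundary_add distrib_left s u cup_add_right)
    qed
    then have "coboundary G (Suc (Suc p)) ?c = cup G (Suc p) 2 f u" ..
    then show ?thesis using Hb_class_coboundary[OF c] by simp
  qed
  moreover obtain f where "f \<in> \<alpha>" using Hb_nonempty[OF \<alpha>] by blast
  ultimately show ?thesis unfolding Hb_cup_def using \<psi>_in_qm_class by blast
qed

lemma Hb_cup_qm_class_left:
  assumes \<alpha>: "\<alpha> \<in> Hb G (Suc q)"
  shows "Hb_cup G 2 (Suc q) (qm_class G \<phi>) \<alpha> = Hb_zero G (2 + Suc q)"
proof -
  have "Hb_class G (2 + Suc q) (cup G 2 (Suc q) u g) = Hb_zero G (2 + Suc q)"
    if g: "g \<in> \<alpha>" and u: "u \<in> qm_class G \<phi>" for g u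
  proof -
    have g: "g \<in> bounded_cochains G (Suc q)" "coboundary G (Suc q) g = (\<lambda>_. 0)"
      using g Hb_subset[OF \<alpha>] by (auto simp: cocycle_bounded cocycle_coboundary)
    obtain b where b: "b \<in> bounded_cochains G 1" and u: "u = (\<lambda>xs. \<psi> xs + coboundary G 1 b xs)"
      using qm_classE[OF u] by blast
    let ?c = "\<lambda>xs. defect_product 0 q const_one g xs + cup G 1 (Suc q) b g xs"
    have "defect_product 0 q const_one g \<in> bounded_cochains G (Suc (Suc q))"
      using defect_product_bounded[of const_one 0 g q] const_one_bounded g by simp
    moreover have "cup G 1 (Suc q) b g \<in> bounded_cochains G (Suc (Suc q))"
      using cup_bounded[OF b g(1)] by simp
    ultimately have c: "?c \<in> bounded_cochains G (Suc (Suc q))"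
      by (intro bounded_cochains_add)
    have "coboundary G (Suc (Suc q)) ?c xs = cup G 2 (Suc q) u g xs" for xs
      using coboundary_cup[of G 1 "Suc q" b g xs]
      by (simp add: coboundary_add coboundary_defect_product_left g cup_zero_right
          u cup_add_left numeral_2_eq_2)
    then have "coboundary G (Suc (Suc q)) ?c = cup G 2 (Suc q) u g" ..
    then show ?thesis using Hb_class_coboundary[OF c] by simp
  qed
  moreover obtain g where "g \<in> \<alpha>" using Hb_nonempty[OF \<alpha>] by blast
  ultimately show ?thesis unfolding Hb_cup_def using \<psi>_in_qm_class by blast
qed

lemma massey_trivial_qm_class:
  assumes \<alpha>: "\<alpha> \<in> Hb G (Suc p)" and \<beta>: "\<beta> \<in> Hb G (Suc q)"
  shows "massey_trivial G (Suc p) 2 (Suc q) \<alpha> (qm_class G \<phi>) \<beta>"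
proof -
  \<comment> \<open>Triviality asks for one vanishing member of the Massey set, so one choice of
    representatives and primitives is enough.\<close>
  obtain f where f\<alpha>: "f \<in> \<alpha>" using Hb_nonempty[OF \<alpha>] by blast
  obtain g where g\<beta>: "g \<in> \<beta>" using Hb_nonempty[OF \<beta>] by blast
  have f: "f \<in> bounded_cochains G (Suc p)" "coboundary G (Suc p) f = (\<lambda>_. 0)"
    using f\<alpha> Hb_subset[OF \<alpha>] by (auto simp: cocycle_bounded cocycle_coboundary)
  have g: "g \<in> bounded_cochains G (Suc q)" "coboundary G (Suc q) g = (\<lambda>_. 0)"
    using g\<beta> Hb_subset[OF \<beta>] by (auto simp: cocycle_bounded cocycle_coboundary)
  let ?u = "insertion 0 q const_one g" and ?v = "insertion p 0 f const_one"
  define s :: real where "s = - ((-1) ^ p)"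
  have s: "s * (s * r) = r" for r using minus_one_power_square[of p r] by (simp add: s_def)
  define b1 where "b1 = (\<lambda>xs. s * defect_product p 0 f const_one xs)"
  define b2 where "b2 = defect_product 0 q const_one g"
  define c where "c = defect_product p q f g"
  let ?E = "\<lambda>xs. (-1) ^ 2 * ((-1) ^ Suc p * cup G (Suc p) (2 + Suc q - 1) f b2 xs
      - cup G (Suc p + 2 - 1) (Suc q) b1 g xs)"
  have b1: "b1 \<in> bounded_cochains G (Suc p + 2 - 1)"
    using defect_product_bounded[OF f(1), of const_one 0] const_one_bounded
    unfolding b1_def by (intro bounded_cochains_mult) simp
  have b2: "b2 \<in> bounded_cochains G (2 + Suc q - 1)"
    using defect_product_bounded[of const_one 0 g q] const_one_bounded g by (simp add: b2_def)
  have d1: "coboundary G (Suc p + 2 - 1) b1 = cup G (Suc p) 2 f \<psi>"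
    using coboundary_defect_product_right[OF f(2)]
    by (simp add: b1_def fun_eq_iff coboundary_mult_left s flip: s_def)
  have d2: "coboundary G (2 + Suc q - 1) b2 = cup G 2 (Suc q) \<psi> g"
    by (simp add: b2_def coboundary_defect_product_left g)
  have cE: "coboundary G (Suc (Suc (p + q))) c xs = ?E xs" for xs
  proof -
    have "cup G (Suc p) (2 + Suc q - 1) f b2 xs = cup G (Suc p) (Suc (Suc q)) f (cup G 1 (Suc q) (qm_hat G \<phi>) g) xs
        + cup G (Suc p) (Suc (Suc q)) f (coboundary G (Suc q) ?u) xs"
      by (simp add: b2_def defect_product_const_one_left g cup_add_right)
    moreover have "cup G (Suc p + 2 - 1) (Suc q) b1 g xs = 
        - ((-1) ^ p) * cup G (Suc (Suc p)) (Suc q) (cup G (Suc p) 1 f (qm_hat G \<phi>)) g xs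
        - cup G (Suc (Suc p)) (Suc q) (coboundary G (Suc p) ?v) g xs"
    proof -
      have "b1 = (\<lambda>xs. s * cup G (Suc p) 1 f (qm_hat G \<phi>) xs - coboundary G (Suc p) ?v xs)"
        using minus_one_power_square[of p]
        by (simp add: b1_def s_def defect_product_const_one_right f fun_eq_iff distrib_left)
      then show ?thesis by (simp only: cup_diff_left cup_mult_left s_def) simp
    qed
    \<comment> \<open>By associativity both parts of \<open>?E\<close> contain the same triple
      product of \<open>f\<close>, \<open>qm_hat\<close> and \<open>g\<close>, and the signs make it
      cancel. Only the coboundaries of \<open>?u\<close> and \<open>?v\<close> remain.\<close>
    moreover have "cup G (Suc (Suc p)) (Suc q) (cup G (Suc p) 1 f (qm_hat G \<phi>)) g =
        cup G (Suc p) (Suc (Suc q)) f (cup G 1 (Suc q) (qm_hat G \<phi>) g)"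
      using cup_assoc[of G "Suc p" 1 "Suc q" f "qm_hat G \<phi>" g] by simp
    ultimately have "?E xs = - ((-1) ^ p) * cup G (Suc p) (Suc (Suc q)) f (coboundary G (Suc q) ?u) xs
       + cup G (Suc (Suc p)) (Suc q) (coboundary G (Suc p) ?v) g xs"
      by (simp add: algebra_simps)
    \<comment> \<open>By the Leibniz rule the remaining terms are the coboundary of
      \<open>f \<union> ?u + ?v \<union> g\<close>, which differs from the bounded cochain
      \<open>c\<close> by an exact one.\<close>
    also have "\<dots> = coboundary G (Suc (Suc (p + q))) c xs"
      using coboundary_cup[of G "Suc p" "Suc q" f ?u xs] coboundary_cup[of G "Suc p" "Suc q" ?v g xs]
      by (simp add: c_def defect_product_eq f g coboundary_add coboundary_mult_left
          coboundary_coboundary cup_zero_left cup_zero_right)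
    finally show ?thesis by simp
  qed
  then have "coboundary G (Suc (Suc (p + q))) c = ?E" ..
  moreover have "c \<in> bounded_cochains G (Suc (Suc (p + q)))"
    unfolding c_def by (rule defect_product_bounded[OF f(1) g(1)])
  ultimately have "Hb_zero G (Suc p + Suc q + 2 - 1) = Hb_class G (Suc p + Suc q + 2 - 1) ?E"
    using Hb_class_coboundary[of c "Suc (Suc (p + q))"] by simp
  then show ?thesis
    unfolding massey_trivial_def massey_def
    using f\<alpha> g\<beta> \<psi>_in_qm_class b1 b2 d1 d2 by blast
qed

end

section \<open>The Cayley tree of a free group\<close>

definition word_inverse :: "('a \<times> bool) list \<Rightarrow> ('a \<times> bool) list" where
  "word_inverse w = rev (map (\<lambda>x. (fst x, \<not> snd x)) w)"

lemma length_word_inverse [simp]: "length (word_inverse w) = length w"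
  by (simp add: word_inverse_def)

lemma word_inverse_Nil [simp]: "word_inverse [] = []"
  by (simp add: word_inverse_def)

lemma word_inverse_append: "word_inverse (u @ v) = word_inverse v @ word_inverse u"
  by (simp add: word_inverse_def)

lemma word_inverse_word_inverse [simp]: "word_inverse (word_inverse w) = w"
  by (simp add: word_inverse_def rev_map comp_def)

lemma fst_set_word_inverse [simp]: "fst ` set (word_inverse w) = fst ` set w"
  by (simp add: word_inverse_def image_image)

lemma word_inverse_reduced: "w \<in> reduced_words S \<Longrightarrow> word_inverse w \<in> reduced_words S"
  unfolding reduced_words_def mem_Collect_eq fst_set_word_inverse
  unfolding word_inverse_def successively_rev successively_map
  by (auto elim: successively_mono)

lemma reduced_words_appendD:
  "u @ v \<in> reduced_words S \<Longrightarrow> u \<in> reduced_words S \<and> v \<in> reduced_words S"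
  by (auto simp: reduced_words_def successively_append_iff)

lemma reduced_words_take: "w \<in> reduced_words S \<Longrightarrow> take n w \<in> reduced_words S"
  using reduced_words_appendD[of "take n w" "drop n w" S] by simp

lemma reduced_words_drop: "w \<in> reduced_words S \<Longrightarrow> drop n w \<in> reduced_words S"
  using reduced_words_appendD[of "take n w" "drop n w" S] by simp

text \<open>The middle letter of a self-inverse word would be its own inverse, or the two middle letters would cancel.\<close>

lemma word_inverse_neq:
  assumes w: "w \<in> reduced_words S" and "w \<noteq> []"
  shows "word_inverse w \<noteq> w"
proof
  assume eq: "word_inverse w = w"
  have nth: "w ! i = (fst (w ! (length w - Suc i)), \<not> snd (w ! (length w - Suc i)))" if "i < length w" for i
    using arg_cong[OF eq, of "\<lambda>v. v ! i"] that by (simp add: word_inverse_def rev_nth)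
  define i where "i = (length w - 1) div 2"
  have i: "i < length w" using \<open>w \<noteq> []\<close> div_le_dividend[of "length w - 1" 2] by (cases w) (auto simp: i_def)
  show False
  proof (cases "odd (length w)")
    case True
    then have "length w - Suc i = i" by (auto simp: i_def elim!: oddE)
    then show False using nth[OF i] by (metis snd_conv)
  next
    case False
    then obtain b where "length w = 2 * b" using evenE[of "length w"] by blast
    moreover obtain c where "b = Suc c" using \<open>w \<noteq> []\<close> calculation by (cases b) auto
    ultimately have j: "length w - Suc i = Suc i" "Suc i < length w" by (simp_all add: i_def)
    then have "\<not> (fst (w ! i) = fst (w ! Suc i) \<and> snd (w ! i) \<noteq> snd (w ! Suc i))"
      using w by (auto simp: reduced_words_def successively_conv_nth)
    then show False using nth[OF i] j by (metis fst_conv snd_conv)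
  qed
qed

text \<open>For two geodesics issuing from one vertex, the end of \<open>u\<close> is where they
  branch, the centre of the tripod.\<close>

lemma common_prefix:
  "\<exists>u s' t'. s = u @ s' \<and> t = u @ t' \<and> (s' = [] \<or> t' = [] \<or> hd s' \<noteq> hd t')"
proof (induction s arbitrary: t)
  case (Cons x s)
  show ?case
  proof (cases "t \<noteq> [] \<and> hd t = x")
    case True
    then obtain t1 where t: "t = x # t1" by (cases t) auto
    obtain u s' t' where "s = u @ s'" "t1 = u @ t'" "s' = [] \<or> t' = [] \<or> hd s' \<noteq> hd t'"
      using Cons.IH by blast
    then show ?thesis using t by (intro exI[of _ "x # u"] exI[of _ s'] exI[of _ t']) auto
  next
    case False
    then show ?thesis by (intro exI[of _ "[]"] exI[of _ "x # s"] exI[of _ t]) auto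
  qed
qed auto

text \<open>Cancellation could occur only at the junction, where the inverse of \<open>hd s\<close>
  meets \<open>hd t\<close>; it would require equal heads.\<close>

lemma word_inverse_append_reduced:
  assumes s: "s \<in> reduced_words S" and t: "t \<in> reduced_words S"
    and ne: "s = [] \<or> t = [] \<or> hd s \<noteq> hd t"
  shows "word_inverse s @ t \<in> reduced_words S"
proof -
  have "last (word_inverse s) = (fst (hd s), \<not> snd (hd s))" if "s \<noteq> []"
    using that by (simp add: word_inverse_def last_rev hd_map)
  then show ?thesis
    using word_inverse_reduced[OF s] t ne
    by (auto simp: reduced_words_def successively_append_iff prod_eq_iff word_inverse_def)
qed

locale free_group = group G for G (structure) +
  fixes S
  assumes free: "freely_generated G S"
begin

section \<open>Values of words and their reduced forms\<close>

lemma letter_value_closed: "fst x \<in> S \<Longrightarrow> letter_value G x \<in> carrier G"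
  using free by (auto simp: freely_generated_def letter_value_def)

lemma word_value_Nil [simp]: "word_value G [] = \<one>"
  by (simp add: word_value_def)

lemma word_value_Cons [simp]: "word_value G (x # w) = letter_value G x \<otimes> word_value G w"
  by (simp add: word_value_def)

lemma word_value_closed: "fst ` set w \<subseteq> S \<Longrightarrow> word_value G w \<in> carrier G"
  by (induction w) (auto simp: letter_value_closed)

lemma word_value_append:
  "fst ` set (u @ v) \<subseteq> S \<Longrightarrow> word_value G (u @ v) = word_value G u \<otimes> word_value G v"
  by (induction u) (auto simp: letter_value_closed word_value_closed m_assoc image_Un)

lemma word_value_inverse:
  "fst ` set w \<subseteq> S \<Longrightarrow> word_value G (word_inverse w) = inv (word_value G w)"
proof (induction w)
  case (Cons x w)
  have x: "fst x \<in> carrier G" using Cons.prems free by (auto simp: freely_generated_def)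
  have "word_value G (word_inverse w @ [(fst x, \<not> snd x)]) =
      word_value G (word_inverse w) \<otimes> letter_value G (fst x, \<not> snd x)"
    by (subst word_value_append) (use Cons.prems in \<open>auto simp: letter_value_closed\<close>)
  also have "letter_value G (fst x, \<not> snd x) = inv (letter_value G x)"
    using x by (simp add: letter_value_def)
  finally show ?case
    using Cons by (simp add: word_inverse_def inv_mult_group word_value_closed letter_value_closed)
qed simp

abbreviation "rw \<equiv> reduced_word G S"

lemma bij_word_value: "bij_betw (word_value G) (reduced_words S) (carrier G)"
  using free by (simp add: freely_generated_def)

lemma rw_reduced: "g \<in> carrier G \<Longrightarrow> rw g \<in> reduced_words S"
  using bij_word_value by (simp add: reduced_word_def bij_betw_def inv_into_into)

lemma word_value_rw: "g \<in> carrier G \<Longrightarrow> word_value G (rw g) = g"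
  using bij_word_value by (simp add: reduced_word_def bij_betw_def f_inv_into_f)

lemma rw_word_value: "w \<in> reduced_words S \<Longrightarrow> rw (word_value G w) = w"
  using bij_word_value by (simp add: reduced_word_def bij_betw_def)

lemma reduced_letters: "w \<in> reduced_words S \<Longrightarrow> fst ` set w \<subseteq> S"
  by (simp add: reduced_words_def)

text \<open>The path that spells the word \<open>s\<close> starts at \<open>a\<close>; the sum is over the starting points of the copies of \<open>w\<close> on it.\<close>

fun occurrence_sum :: "('a \<times> bool) list \<Rightarrow> ('a \<Rightarrow> real) \<Rightarrow> 'a \<Rightarrow> ('a \<times> bool) list \<Rightarrow> real" where
  "occurrence_sum w h a [] = 0"
| "occurrence_sum w h a (x # s) = (if take (length w) (x # s) = w then h a else 0)
     + occurrence_sum w h (a \<otimes> letter_value G x) s"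

lemma occurrence_sum_add:
  "occurrence_sum w (\<lambda>x. h x + k x) a s = occurrence_sum w h a s + occurrence_sum w k a s"
  by (induction s arbitrary: a) auto

lemma occurrence_sum_mult:
  "occurrence_sum w (\<lambda>x. c * h x) a s = c * occurrence_sum w h a s"
  by (induction s arbitrary: a) (auto simp: algebra_simps)

lemma occurrence_sum_cong:
  "\<lbrakk>\<And>x. x \<in> carrier G \<Longrightarrow> h x = k x; a \<in> carrier G; fst ` set s \<subseteq> S\<rbrakk> \<Longrightarrow>
    occurrence_sum w h a s = occurrence_sum w k a s"
  by (induction s arbitrary: a) (auto simp: letter_value_closed)

lemma occurrence_sum_equivariant:
  "\<lbrakk>g \<in> carrier G; a \<in> carrier G; fst ` set s \<subseteq> S\<rbrakk> \<Longrightarrow>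
    occurrence_sum w h (g \<otimes> a) s = occurrence_sum w (\<lambda>x. h (g \<otimes> x)) a s"
  by (induction s arbitrary: a) (auto simp: letter_value_closed m_assoc)

text \<open>The error comes from copies of \<open>w\<close> that start on \<open>s\<close> and end
  on \<open>t\<close>; their starting points are among the last \<open>length w\<close> positions of
  \<open>s\<close>.\<close>

lemma occurrence_sum_append:
  assumes h: "\<And>x. x \<in> carrier G \<Longrightarrow> \<bar>h x\<bar> \<le> C"
  shows "\<lbrakk>a \<in> carrier G; fst ` set s \<subseteq> S; fst ` set t \<subseteq> S\<rbrakk> \<Longrightarrow>
    \<bar>occurrence_sum w h a (s @ t) - occurrence_sum w h a s - occurrence_sum w h (a \<otimes> word_value G s) t\<bar>
      \<le> real (min (length s) (length w)) * C"
proof (induction s arbitrary: a)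
  case (Cons x s)
  have x: "letter_value G x \<in> carrier G" using Cons.prems by (simp add: letter_value_closed)
  have s: "word_value G s \<in> carrier G" using Cons.prems by (simp add: word_value_closed)
  let ?b = "a \<otimes> letter_value G x"
  have IH: "\<bar>occurrence_sum w h ?b (s @ t) - occurrence_sum w h ?b s
      - occurrence_sum w h (?b \<otimes> word_value G s) t\<bar> \<le> real (min (length s) (length w)) * C"
    by (rule Cons.IH) (use Cons.prems x in auto)
  have ass: "?b \<otimes> word_value G s = a \<otimes> word_value G (x # s)"
    using Cons.prems x s by (simp add: m_assoc)
  show ?case
  proof (cases "length w \<le> length (x # s)")
    case True
    \<comment> \<open>The window starting here fits into \<open>x # s\<close>, so appending
      \<open>t\<close> does not affect it.\<close>
    then have "take (length w) ((x # s) @ t) = take (length w) (x # s)"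
      by (simp only: take_append) simp
    moreover have "real (min (length s) (length w)) * C \<le> real (min (length (x # s)) (length w)) * C"
      using h[OF Cons.prems(1)] by (intro mult_right_mono) auto
    ultimately show ?thesis using IH ass by simp
  next
    case False
    \<comment> \<open>The window sticks out: \<open>x # s\<close> alone has no copy here, and
      appending \<open>t\<close> creates at most one.\<close>
    then have "take (length w) (x # s) \<noteq> w" by (metis take_all nat_le_linear)
    moreover have "\<bar>if take (length w) ((x # s) @ t) = w then h a else 0\<bar> \<le> C"
      using h[OF Cons.prems(1)] by auto
    moreover have "real (min (length (x # s)) (length w)) * C
        = C + real (min (length s) (length w)) * C"
      using False by (simp add: algebra_simps)
    ultimately show ?thesis using IH ass by (simp split: if_splits)
  qed
qed simp

text \<open>Inverse copies of \<open>w\<close> are counted as copies on the reversed path, and hence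
  represented by their far end. This makes the sum change sign exactly under reversal.\<close>

definition path_sum :: "('a \<times> bool) list \<Rightarrow> ('a \<Rightarrow> real) \<Rightarrow> 'a \<Rightarrow> ('a \<times> bool) list \<Rightarrow> real" where
  "path_sum w h a s =
     occurrence_sum w h a s - occurrence_sum w h (a \<otimes> word_value G s) (word_inverse s)"

text \<open>Each of the two directions contributes an error of \<open>length w * C\<close>. The
  reversed path first reads the inverse of \<open>t\<close>, which leads back to the
  junction.\<close>

lemma path_sum_append:
  assumes h: "\<And>x. x \<in> carrier G \<Longrightarrow> \<bar>h x\<bar> \<le> C"
    and a: "a \<in> carrier G" and s: "fst ` set s \<subseteq> S" and t: "fst ` set t \<subseteq> S"
  shows "\<bar>path_sum w h a (s @ t) - path_sum w h a s - path_sum w h (a \<otimes> word_value G s) t\<bar>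
    \<le> 2 * real (length w) * C"
proof -
  let ?s = "word_value G s" and ?t = "word_value G t"
  have car: "?s \<in> carrier G" "?t \<in> carrier G" using s t by (simp_all add: word_value_closed)
  have st: "word_value G (s @ t) = ?s \<otimes> ?t" using s t by (intro word_value_append) auto
  have C: "C \<ge> 0" using h[OF a] by linarith
  have min: "real (min n (length w)) * C \<le> real (length w) * C" for n
    using C by (intro mult_right_mono) auto
  have 1: "\<bar>occurrence_sum w h a (s @ t) - occurrence_sum w h a s
      - occurrence_sum w h (a \<otimes> ?s) t\<bar> \<le> real (length w) * C"
    using occurrence_sum_append[where h = h, OF h a s t] min by (rule order_trans)
  have "\<bar>occurrence_sum w h (a \<otimes> (?s \<otimes> ?t)) (word_inverse t @ word_inverse s)
      - occurrence_sum w h (a \<otimes> (?s \<otimes> ?t)) (word_inverse t)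
      - occurrence_sum w h (a \<otimes> (?s \<otimes> ?t) \<otimes> word_value G (word_inverse t)) (word_inverse s)\<bar>
      \<le> real (length w) * C"
    by (rule order_trans[OF occurrence_sum_append[where h = h, OF h] min]) (use a car s t in auto)
  moreover have "a \<otimes> (?s \<otimes> ?t) \<otimes> word_value G (word_inverse t) = a \<otimes> ?s"
    using a car t by (simp add: word_value_inverse m_assoc)
  ultimately have 2: "\<bar>occurrence_sum w h (a \<otimes> (?s \<otimes> ?t)) (word_inverse t @ word_inverse s)
      - occurrence_sum w h (a \<otimes> (?s \<otimes> ?t)) (word_inverse t)
      - occurrence_sum w h (a \<otimes> ?s) (word_inverse s)\<bar> \<le> real (length w) * C" by simp
  have "a \<otimes> ?s \<otimes> ?t = a \<otimes> (?s \<otimes> ?t)" using a car by (simp add: m_assoc)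
  then show ?thesis
    using 1 2 unfolding path_sum_def st word_inverse_append by simp
qed

lemma path_sum_inverse:
  assumes "a \<in> carrier G" "fst ` set s \<subseteq> S"
  shows "path_sum w h (a \<otimes> word_value G s) (word_inverse s) = - path_sum w h a s"
proof -
  have "a \<otimes> word_value G s \<otimes> word_value G (word_inverse s) = a"
    using assms by (simp add: word_value_inverse word_value_closed m_assoc)
  then show ?thesis by (simp add: path_sum_def)
qed

definition geodesic_sum :: "('a \<times> bool) list \<Rightarrow> ('a \<Rightarrow> real) \<Rightarrow> 'a \<Rightarrow> 'a \<Rightarrow> real" where
  "geodesic_sum w h a b = path_sum w h a (rw (inv a \<otimes> b))"

text \<open>
  The three geodesics of a triangle are pairwise concatenations of the three legs of a tripod, and
  the contributions of every leg cancel.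
\<close>

lemma geodesic_sum_triangle:
  assumes h: "\<And>x. x \<in> carrier G \<Longrightarrow> \<bar>h x\<bar> \<le> C"
    and a: "a \<in> carrier G" and b: "b \<in> carrier G" and c: "c \<in> carrier G"
  shows "\<bar>geodesic_sum w h b c - geodesic_sum w h a c + geodesic_sum w h a b\<bar>
    \<le> 6 * real (length w) * C"
proof -
  obtain u s t where us: "rw (inv a \<otimes> b) = u @ s" and ut: "rw (inv a \<otimes> c) = u @ t"
    and ne: "s = [] \<or> t = [] \<or> hd s \<noteq> hd t"
    using common_prefix by blast
  have "u @ s \<in> reduced_words S" "u @ t \<in> reduced_words S"
    using rw_reduced[of "inv a \<otimes> b"] rw_reduced[of "inv a \<otimes> c"] a b c by (simp_all add: us ut)
  then have red: "s \<in> reduced_words S" "t \<in> reduced_words S" "u \<in> reduced_words S"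
    by (blast dest: reduced_words_appendD)+
  then have letters: "fst ` set u \<subseteq> S" "fst ` set s \<subseteq> S" "fst ` set t \<subseteq> S"
    by (simp_all add: reduced_letters)
  let ?u = "word_value G u" and ?s = "word_value G s" and ?t = "word_value G t"
  have car: "?u \<in> carrier G" "?s \<in> carrier G" "?t \<in> carrier G"
    using letters by (simp_all add: word_value_closed)
  have ab: "?u \<otimes> ?s = inv a \<otimes> b" and ac: "?u \<otimes> ?t = inv a \<otimes> c"
    using word_value_rw[of "inv a \<otimes> b"] word_value_rw[of "inv a \<otimes> c"] a b c letters
      word_value_append[of u s] word_value_append[of u t] by (simp_all add: us ut image_Un)
  have b_eq: "b = a \<otimes> ?u \<otimes> ?s" and c_eq: "c = a \<otimes> ?u \<otimes> ?t"
    using a b c car ab ac by (simp_all add: m_assoc) (simp_all add: m_assoc[symmetric])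
  \<comment> \<open>The centre of the tripod: the legs from \<open>p\<close> to \<open>b\<close> and
    \<open>c\<close> spell \<open>s\<close> and \<open>t\<close>, and \<open>u\<close> leads from
    \<open>a\<close> to \<open>p\<close>.\<close>
  define p where "p = a \<otimes> ?u"
  have p: "p \<in> carrier G" using a car by (simp add: p_def)
  have "word_value G (word_inverse s @ t) = inv ?s \<otimes> ?t"
    using letters word_value_append[of "word_inverse s" t] by (simp add: word_value_inverse image_Un)
  also have "\<dots> = inv b \<otimes> c"
    unfolding b_eq c_eq p_def[symmetric] using p car by (simp add: inv_mult_group m_assoc)
      (simp add: m_assoc[symmetric])
  finally have bc: "rw (inv b \<otimes> c) = word_inverse s @ t"
    using rw_word_value[OF word_inverse_append_reduced[OF red(1,2) ne]] by simp
  have bs: "b \<otimes> word_value G (word_inverse s) = p"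
    using p car letters by (simp add: b_eq p_def[symmetric] word_value_inverse m_assoc)
  have 1: "\<bar>geodesic_sum w h a b - path_sum w h a u - path_sum w h p s\<bar> \<le> 2 * real (length w) * C"
    unfolding geodesic_sum_def us p_def using letters by (intro path_sum_append h a) auto
  have 2: "\<bar>geodesic_sum w h a c - path_sum w h a u - path_sum w h p t\<bar> \<le> 2 * real (length w) * C"
    unfolding geodesic_sum_def ut p_def using letters by (intro path_sum_append h a) auto
  have 3: "\<bar>geodesic_sum w h b c - path_sum w h b (word_inverse s) - path_sum w h p t\<bar>
      \<le> 2 * real (length w) * C"
    unfolding geodesic_sum_def bc bs[symmetric] using letters by (intro path_sum_append h b) auto
  \<comment> \<open>The leg between \<open>p\<close> and \<open>b\<close> is traversed in opposite
    directions by two sides. Once all legs cancel, three errors of \<open>2 * length w * C\<close>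
    remain.\<close>
  have "path_sum w h b (word_inverse s) = - path_sum w h p s"
    using path_sum_inverse[of p s w h] p letters by (simp add: b_eq p_def)
  with 1 2 3 show ?thesis by linarith
qed

section \<open>Comparison with the Brooks counting function\<close>

lemma occurrence_sum_one:
  assumes "w \<noteq> []"
  shows "occurrence_sum w (\<lambda>_. 1) a s =
    (\<Sum>i<Suc (length s) - length w. if take (length w) (drop i s) = w then 1 else 0)"
proof (induction s arbitrary: a)
  case Nil
  \<comment> \<open>An empty \<open>w\<close> would give one index here, whereas the recursion
    counts nothing at the end of the path.\<close>
  have "Suc 0 - length w = 0" using assms by (cases w) auto
  then show ?case by simp
next
  case (Cons x s)
  show ?case
  proof (cases "length w \<le> Suc (length s)")
    case True
    then have "Suc (length (x # s)) - length w = Suc (Suc (length s) - length w)" by simp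
    then show ?thesis by (simp only: sum.lessThan_Suc_shift) (simp add: Cons)
  next
    case False
    \<comment> \<open>The recursion also tests positions with too few letters left, where no copy
      can start.\<close>
    then have "take (length w) (x # s) \<noteq> w" by auto
    then show ?thesis using False by (simp add: Cons)
  qed
qed

lemma take_drop_word_inverse:
  assumes "i + l \<le> length s"
  shows "take l (drop (length s - l - i) (word_inverse s)) = word_inverse (take l (drop i s))"
  using assms by (simp add: word_inverse_def drop_rev take_rev take_map drop_map drop_take)

lemma occurrence_sum_one_word_inverse:
  assumes "w \<noteq> []"
  shows "occurrence_sum w (\<lambda>_. 1) a (word_inverse s) =
    (\<Sum>i<Suc (length s) - length w. if take (length w) (drop i s) = word_inverse w then 1 else 0)"
proof -
  let ?n = "Suc (length s) - length w"
  have "occurrence_sum w (\<lambda>_. 1) a (word_inverse s) =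
    (\<Sum>i<?n. if take (length w) (drop i (word_inverse s)) = w then 1 else 0)"
    using occurrence_sum_one[OF assms, of a "word_inverse s"] by simp
  \<comment> \<open>Reversing the index pairs each window of \<open>s\<close> with the window of its
    inverse that reads the same stretch backwards.\<close>
  also have "\<dots> = (\<Sum>i<?n. if take (length w) (drop (?n - Suc i) (word_inverse s)) = w then 1 else 0)"
    by (rule sum.nat_diff_reindex[symmetric])
  also have "\<dots> = (\<Sum>i<?n. if take (length w) (drop i s) = word_inverse w then 1 else 0)"
  proof (rule sum.cong[OF refl])
    fix i assume "i \<in> {..<?n}"
    then have i: "i + length w \<le> length s" "?n - Suc i = length s - length w - i" by auto
    show "(if take (length w) (drop (?n - Suc i) (word_inverse s)) = w then 1 else 0 :: real) =
        (if take (length w) (drop i s) = word_inverse w then 1 else 0)"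
      unfolding i(2) take_drop_word_inverse[OF i(1)] by (metis word_inverse_word_inverse)
  qed
  finally show ?thesis .
qed

lemma brooks_eq_geodesic_sum:
  assumes \<omega>: "\<omega> \<in> carrier G" "\<omega> \<noteq> \<one>" and g: "g \<in> carrier G"
  shows "brooks G S \<omega> g = geodesic_sum (rw \<omega>) (\<lambda>_. 1) \<one> g"
proof -
  define w s where "w = rw \<omega>" and "s = rw g"
  have w: "w \<in> reduced_words S" and s: "s \<in> reduced_words S"
    using \<omega> g by (simp_all add: w_def s_def rw_reduced)
  have \<omega>w: "\<omega> = word_value G w" using \<omega> by (simp add: w_def word_value_rw)
  have wne: "w \<noteq> []" using \<omega>(2) \<omega>w by auto
  have inv\<omega>: "inv \<omega> = word_value G (word_inverse w)"
    using w by (simp add: \<omega>w word_value_inverse reduced_letters)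
  have inj: "word_value G u = word_value G v \<longleftrightarrow> u = v" if "u \<in> reduced_words S" "v \<in> reduced_words S" for u v
    using that rw_word_value by metis
  \<comment> \<open>\<open>brooks_chi\<close> compares group elements, \<open>occurrence_sum\<close>
    compares words; uniqueness of reduced words identifies the two. As no nonempty reduced word is
    its own inverse, the nested conditional is a difference of indicators.\<close>
  have chi: "brooks_chi G \<omega> (word_value G (take (length w) (drop i s))) =
      (if take (length w) (drop i s) = w then 1 else 0)
      - (if take (length w) (drop i s) = word_inverse w then 1 else 0)" for i
  proof -
    have "take (length w) (drop i s) \<in> reduced_words S"
      using s by (intro reduced_words_take reduced_words_drop)
    then show ?thesis
      using w word_inverse_reduced[OF w] word_inverse_neq[OF w wne]
      by (simp add: brooks_chi_def inv\<omega>) (simp add: \<omega>w inj)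
  qed
  have "brooks G S \<omega> g = occurrence_sum w (\<lambda>_. 1) \<one> s -
      occurrence_sum w (\<lambda>_. 1) (\<one> \<otimes> word_value G s) (word_inverse s)"
    unfolding occurrence_sum_one_word_inverse[OF wne] unfolding occurrence_sum_one[OF wne]
    by (simp add: brooks_def Let_def chi sum_subtractf flip: w_def s_def)
  then show ?thesis using g by (simp add: geodesic_sum_def path_sum_def flip: w_def s_def)
qed

text \<open>Equivariance holds because a translation preserves the label
  \<open>inv a \<otimes> b\<close> of a geodesic and moves only its base point.\<close>

lemma geodesic_sum_quasi_additive:
  assumes \<omega>: "\<omega> \<in> carrier G" "\<omega> \<noteq> \<one>"
  shows "equivariant_quasi_additive G (geodesic_sum (rw \<omega>)) (brooks G S \<omega>)"
proof unfold_locales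
  let ?w = "rw \<omega>"
  have letters: "fst ` set (rw g) \<subseteq> S" if "g \<in> carrier G" for g
    using that by (simp add: rw_reduced reduced_letters)
  show "geodesic_sum ?w (\<lambda>x. h x + k x) a b = geodesic_sum ?w h a b + geodesic_sum ?w k a b" for h k a b
    by (simp add: geodesic_sum_def path_sum_def occurrence_sum_add)
  show "geodesic_sum ?w (\<lambda>x. c * h x) a b = c * geodesic_sum ?w h a b" for c h a b
    by (simp add: geodesic_sum_def path_sum_def occurrence_sum_mult algebra_simps)
  show "geodesic_sum ?w h a b = geodesic_sum ?w k a b"
    if ab: "a \<in> carrier G" "b \<in> carrier G" and hk: "\<And>x. x \<in> carrier G \<Longrightarrow> h x = k x" for a b h k
    using ab letters[of "inv a \<otimes> b"]
    by (simp add: geodesic_sum_def path_sum_def word_value_rw occurrence_sum_cong[OF hk])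
  show "geodesic_sum ?w h (g \<otimes> a) (g \<otimes> b) = geodesic_sum ?w (\<lambda>x. h (g \<otimes> x)) a b"
    if g: "g \<in> carrier G" and ab: "a \<in> carrier G" "b \<in> carrier G" for g a b h
  proof -
    have "inv g \<otimes> (g \<otimes> b) = b" using g ab by (simp flip: m_assoc)
    then have 1: "inv (g \<otimes> a) \<otimes> (g \<otimes> b) = inv a \<otimes> b"
      using g ab by (simp add: inv_mult_group m_assoc)
    show ?thesis
      using g ab letters[of "inv a \<otimes> b"]
      by (simp add: geodesic_sum_def path_sum_def 1 word_value_closed m_assoc occurrence_sum_equivariant)
  qed
  show "\<exists>K \<ge> 0. \<forall>h. \<forall>C \<ge> 0. \<forall>a \<in> carrier G. \<forall>b \<in> carrier G. \<forall>c \<in> carrier G.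
      (\<forall>x \<in> carrier G. \<bar>h x\<bar> \<le> C) \<longrightarrow>
      \<bar>geodesic_sum ?w h b c - geodesic_sum ?w h a c + geodesic_sum ?w h a b\<bar> \<le> K * C"
    using geodesic_sum_triangle by (intro exI[of _ "6 * real (length ?w)"]) auto
  show "brooks G S \<omega> g = geodesic_sum ?w (\<lambda>_. 1) \<one> g" if "g \<in> carrier G" for g
    using brooks_eq_geodesic_sum[OF \<omega> that] .
qed

end

theorem theorem5p7:
  fixes F :: "('a, 'b) monoid_scheme" and S :: "'a set" and \<omega> :: 'a
  assumes "group F" and "\<not> comm_group F" and "freely_generated F S"
    and "\<omega> \<in> carrier F" and "\<omega> \<noteq> \<one>\<^bsub>F\<^esub>"
  shows "quasimorphism F (brooks F S \<omega>) \<and>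
    (\<forall>n m. n \<ge> 1 \<longrightarrow> m \<ge> 1 \<longrightarrow> (\<forall>\<alpha>1 \<in> Hb F n. \<forall>\<alpha>2 \<in> Hb F m.
       Hb_cup F n 2 \<alpha>1 (qm_class F (brooks F S \<omega>)) = Hb_zero F (n + 2) \<and>
       Hb_cup F 2 m (qm_class F (brooks F S \<omega>)) \<alpha>2 = Hb_zero F (2 + m) \<and>
       massey_trivial F n 2 m \<alpha>1 (qm_class F (brooks F S \<omega>)) \<alpha>2))"
proof -
  interpret free_group F S
    using assms(1,3) by (simp add: free_group_def free_group_axioms_def)
  interpret equivariant_quasi_additive F "geodesic_sum (reduced_word F S \<omega>)" "brooks F S \<omega>"
    by (rule geodesic_sum_quasi_additive[OF assms(4,5)])
  show ?thesis
  proof (intro conjI allI impI ballI)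
    show "quasimorphism F (brooks F S \<omega>)" by (rule quasimorphism_\<phi>)
  next
    fix n m :: nat and \<alpha> \<beta>
    assume "n \<ge> 1" "m \<ge> 1" and \<alpha>: "\<alpha> \<in> Hb F n" and \<beta>: "\<beta> \<in> Hb F m"
    \<comment> \<open>Positive degrees leave each cochain an entry for the integration variable
      besides the endpoint of the segment.\<close>
    then obtain p q where n: "n = Suc p" and m: "m = Suc q" by (auto simp: Suc_le_D dest!: Suc_le_D)
    show "Hb_cup F n 2 \<alpha> (qm_class F (brooks F S \<omega>)) = Hb_zero F (n + 2)"
      using Hb_cup_qm_class_right[OF \<alpha>[unfolded n]] by (simp only: n)
    show "Hb_cup F 2 m (qm_class F (brooks F S \<omega>)) \<beta> = Hb_zero F (2 + m)"
      using Hb_cup_qm_class_left[OF \<beta>[unfolded m]] by (simp only: m)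
    show "massey_trivial F n 2 m \<alpha> (qm_class F (brooks F S \<omega>)) \<beta>"
      using massey_trivial_qm_class[OF \<alpha>[unfolded n] \<beta>[unfolded m]] by (simp only: n m)
  qed
qed

end
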